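(* Fix a mesh $M$. Let $\Gamma \vdash^{\mathrm{core}} \mathsf{C}[e] : \mathtt{tensor}\langle\bar n\rangle$, where $\mathsf{C}$ is a simple context and $e$ a Core expression, and let $\bar\sigma$ be a sequence of loop actions with $\mathrm{axes}(\bar\sigma)=a_1\cdots a_k$, where $r_{a_1},\ldots,r_{a_k}$ are the range variables in $\Gamma$ (in this order). Let $\mathcal{M}$ be a variable map, $e'$ an SPMD expression, and $\gamma\in\llbracket\Gamma\rrbracket$, $\gamma'\in\llbracket\Gamma_{\mathcal{M}}\rrbracket$ environments such that (i) $\Gamma\vdash\mathcal{M}$; (ii) $\mathcal{M};\bar\sigma\vdash\langle\mathsf{C};e\rangle\rightsquigarrow e'$; (iii) $\gamma\sim_{\mathcal{M}}\gamma'$. Then $$\llbracket \Gamma_{\mathcal{M}} \vdash^{\mathrm{spmd}} e' : \mathtt{dtensor}\langle a_1\cdots a_k,\bar n\rangle\rrbracket\,\gamma'\,\gamma(r_{a_1})\cdots\gamma(r_{a_k}) = \llbracket\Gamma\vdash^{\mathrm{core}}\mathsf{C}[e]:\mathtt{tensor}\langle\bar n\rangle\rrbracket\,\gamma .$$ (The left-hand side is well defined because under these hypotheses $\Gamma_{\mathcal{M}} \vdash^{\mathrm{spmd}} e' : \mathtt{dtensor}\langle a_1\cdots a_k,\bar n\rangle$ holds, by the typing simulation property of the translation.)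
   Context: Bars denote finite sequences; $\cdot$ is the empty sequence; $-$ is the hole of a context; $\mathsf{C}[e]$ is hole filling; $e[\bar y/\bar z]$ is simultaneous substitution of variables; $\mathrm{free}(\cdot)$ denotes the set of free tensor variables. **Mesh.** A fixed mesh $M=\{a_1{:}n_1,\dots,a_p{:}n_p\}$ assigns to each axis name a positive size. For each axis $a$ there is one range variable $r_a$. **Core language.** Types $\tau ::= \mathtt{tensor}\langle\bar n\rangle$ ($\bar n$ a shape). A fixed set of tensor operations $op$ is given, each with a typing (operand types determine the result type) and an interpretation as a function on arrays. Loop actions $\sigma ::= \mathtt{tile}\langle a,d\rangle \mid \mathtt{sum}\langle a\rangle$ ($d$ a dimension index). Values $v ::= op(\bar x)\mid \mathtt{loop}_a\,\sigma\,(\lambda r_a.e)\mid \mathtt{slice}\ d\ x[r_a]$. Expressions $e ::= \mathtt{let}\ x{:}\tau=v\ \mathtt{in}\ e\mid\mathtt{yield}(x)$. Typing contexts $\Gamma$ are ordered lists of tensor variables $x{:}\tau$ and range variables $r_a$. Typing $\Gamma\vdash^{\mathrm{core}}\cdot:\tau$ (mesh suppressed): - if $\Gamma,r_a\vdash^{\mathrm{core}} e:\mathtt{tensor}\langle\ldots,n_d,\ldots\rangle$, $r_a\notin\Gamma$, $a{:}n\in M$, then $\Gamma\vdash^{\mathrm{core}}\mathtt{loop}_a\,\mathtt{tile}\langle a,d\rangle\,(\lambda r_a.e):\mathtt{tensor}\langle\ldots,n_d\cdot n,\ldots\rangle$; - if $\Gamma,r_a\vdash^{\mathrm{core}} e:\tau$,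 $r_a\notin\Gamma$, $a\in M$, then $\Gamma\vdash^{\mathrm{core}}\mathtt{loop}_a\,\mathtt{sum}\langle a\rangle\,(\lambda r_a.e):\tau$; - if $x{:}\mathtt{tensor}\langle\ldots,n_d\cdot n,\ldots\rangle\in\Gamma$, $r_a\in\Gamma$, $a{:}n\in M$, then $\Gamma\vdash^{\mathrm{core}}\mathtt{slice}\ d\ x[r_a]:\mathtt{tensor}\langle\ldots,n_d,\ldots\rangle$; - the usual rules for $op$, $\mathtt{let}$ and $\mathtt{yield}$. **Core semantics.** $\llbracket\mathtt{tensor}\langle\bar n\rangle\rrbracket$ is the space of arrays of shape $\bar n$; $\llbracket a\rrbracket=\{0,\dots,n-1\}$ for $a{:}n\in M$. $\llbracket\Gamma\rrbracket$ is the set of environments $\gamma$ with $\mathrm{dom}(\gamma)=\mathrm{dom}(\Gamma)$, $\gamma(x)\in\llbracket\tau\rrbracket$ for $x{:}\tau\in\Gamma$, and $\gamma(r_a)\in\llbracket a\rrbracket$ for $r_a\in\Gamma$. $\llbracket\Gamma\vdash^{\mathrm{core}} e:\tau\rrbracket:\llbracket\Gamma\rrbracket\to\llbracket\tau\rrbracket$ is defined by: - $\mathtt{loop}_a\,\mathtt{tile}\langle a,d\rangle(\lambda r_a.e)$ at $\gamma$: concatenation along dimension $d$, written $\bigoplus^{axis=d}_{i\in\llbracket a\rrbracket}$, in the order $i=0,1,\dots$, of the values of $e$ at $\gamma\cup\{r_a\mapsto i\}$; - $\mathtt{loop}_a\,\mathtt{sum}\langle a\rangle(\lambda r_a.e)$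 at $\gamma$: $\sum_{i\in\llbracket a\rrbracket}$ of the values of $e$ at $\gamma\cup\{r_a\mapsto i\}$; - $\mathtt{slice}\ d\ x[r_a]:\mathtt{tensor}\langle\ldots,n_d,\ldots\rangle$ at $\gamma$: the subarray of $\gamma(x)$ whose $d$-th index ranges over $\gamma(r_a)n_d,\dots,(\gamma(r_a)+1)n_d-1$; - $op(\bar x)$ at $\gamma$: $op(\overline{\gamma(x)})$; $\mathtt{yield}(x)$ at $\gamma$: $\gamma(x)$; $\mathtt{let}\ x{:}\tau=v\ \mathtt{in}\ e$ at $\gamma$: value of $e$ at $\gamma\cup\{x\mapsto\llbracket v\rrbracket\gamma\}$. **SPMD language.** Distributed dimensions $\rho::=\{\bar a\}n\mid n$ (with $\{\}n$ meaning $n$); distributed types $\mu::=\mathtt{dtensor}\langle\bar a,\bar\rho\rangle\mid\tau$, where $\bar a$ are the stacked axes. $\mathtt{tensor}\langle\bar n\rangle$ and $\mathtt{dtensor}\langle\cdot,\bar n\rangle$ are identified. Local sizes: $\mathcal{L}[n]=n$, $\mathcal{L}[\{\bar a,a\}n]=\mathcal{L}[\{\bar a\}(n/m)]$ for $a{:}m\in M$; $\mathcal{L}[\mathtt{dtensor}\langle\bar a,\bar\rho\rangle]=\mathtt{tensor}\langle\overline{\mathcal{L}[\rho]}\rangle$. Global sizes: $\mathcal{G}[n]=n$, $\mathcal{G}[\{\bar a\}n]=n$. Values: $op(\bar x)$; $\mathtt{execute}\ \bar a\ \bar x\ (\lambda\bar r.\lambda\bar y.e)$ with $e$ a Core expression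 (allowed here to yield a tuple); $\mathtt{redistribute}\ x\blacktriangleright\mu$; $\mathtt{tile\_reduce}\ \sigma\ x$. Expressions: $\mathtt{let}\ x_1{:}\mu_1,\dots,x_n{:}\mu_n=v\ \mathtt{in}\ e\mid\mathtt{yield}(\bar x)$. SPMD contexts contain only tensor variables $x{:}\mu$. Typing: - if $x_i:\mu_i$ in $\Gamma$, $\tau_i=\mathcal{L}[\mu_i]$, $\bar a=a_1\cdots a_k$, $\bar r=r_{a_1}\cdots r_{a_k}$ and $\bar r,\overline{y{:}\tau}\vdash^{\mathrm{core}} e:\mathtt{tensor}\langle\bar n\rangle$, then $\mathtt{execute}\ \bar a\ \bar x\,(\lambda\bar r.\lambda\bar y.e):\mathtt{dtensor}\langle\bar a,\bar n\rangle$ (componentwise if $e$ yields a tuple); - $\mathtt{redistribute}\ x\blacktriangleright\mu_2:\mu_2$ if $x:\mu_1$ where $\mu_1,\mu_2$ have the same stacked axes and the same global sizes in each dimension; - $\mathtt{tile\_reduce}\ \mathtt{sum}\langle a\rangle\ x:\mathtt{dtensor}\langle\bar a,\bar\rho\rangle$ if $x:\mathtt{dtensor}\langle\bar a a,\bar\rho\rangle$; - $\mathtt{tile\_reduce}\ \mathtt{tile}\langle a,d\rangle\ x:\mathtt{dtensor}\langle\bar a,[\ldots,\{\bar c_d,a\}(n_d\cdot n),\ldots]\rangle$ if $x:\mathtt{dtensor}\langle\bar aa,[\ldots,\{\bar c_d\}n_d,\ldots]\rangle$, $a{:}n\in M$; - $op(\bar x)$ is typed as in Core, on operands and results with no stacked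 axes and no distributed dimensions; usual rules for (tuple) $\mathtt{let}$ and $\mathtt{yield}$. **SPMD semantics** (only for the types and instructions produced by the translation below). $\llbracket\mathtt{dtensor}\langle a_1\cdots a_k,\bar n\rangle\rrbracket=\llbracket a_1\rrbracket\to\cdots\to\llbracket a_k\rrbracket\to\llbracket\mathtt{tensor}\langle\bar n\rangle\rrbracket$; if exactly one dimension is distributed, by a single axis $a$ (dimension $\{a\}N_d$), the interpretation is $\llbracket a_1\rrbracket\to\cdots\to\llbracket a_k\rrbracket\to\llbracket a\rrbracket\to\llbracket\mathtt{tensor}\langle\ldots\rangle\rrbracket$ with target the local type (size $N_d/n$ in dimension $d$, $a{:}n\in M$). Environments are typed as in Core. At an environment $\gamma$: - $\mathtt{execute}\ \bar a\ \bar x\,(\lambda\bar r.\lambda\bar y.e)$: the function $\lambda\bar i.$ (Core value of $e$ at $\{\overline{r\mapsto i}\}\cup\{\overline{y\mapsto\gamma(x)\bar i}\}$), where $\gamma(x)\bar i$ applies $\gamma(x)$ to as many (initial) indices of $\bar i$ as there are stacked axes in the type of $x$; a tuple-yielding $e$ gives a tuple of such functions; - $\mathtt{tile\_reduce}\ \mathtt{sum}\langle a\rangle\ x$ with $x:\mathtt{dtensor}\langle\bar aa,\bar n\rangle$: $\lambda\bar i.\sum_{j\in\llbracket a\rrbracket}\gamma(x)\,\bar i\,j$; - $\mathtt{tile\_reduce}\ \mathtt{tile}\langle a,d\rangle\ x$ with $x:\mathtt{dtensor}\langle\bar aa,\bar n\rangle$: $\lambda\bar i.\lambda j.\gamma(x)\,\bar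 i\,j$; - $\mathtt{redistribute}\ x\blacktriangleright\mathtt{dtensor}\langle\bar a,\bar n\rangle$, where $x$ has stacked axes $\bar a$ and only dimension $d$ distributed, by $a$: $\lambda\bar i.\bigoplus^{axis=d}_{j\in\llbracket a\rrbracket}\gamma(x)\,\bar i\,j$; - $op$, $\mathtt{yield}$, $\mathtt{let}$: as in Core (componentwise for tuples). **Auxiliary notions.** Simple contexts $\mathsf{C}::=-\mid\mathtt{let}\ x{:}\tau=op(\bar x)\ \mathtt{in}\ \mathsf{C}\mid\mathtt{let}\ x{:}\tau=\mathtt{slice}\ d\ y[r_a]\ \mathtt{in}\ \mathsf{C}$; $\mathrm{defs}(\mathsf{C})$ is the set of $x{:}\tau$ bound by $\mathsf{C}$. SPMD contexts $\mathsf{C}^{s}::=-\mid\mathtt{let}\ \overline{x{:}\mu}=v\ \mathtt{in}\ \mathsf{C}^{s}$. $\mathrm{axes}(\bar\sigma)$ lists the axes of the actions in $\bar\sigma$ in order. A variable map $\mathcal{M}$ is a finite list of entries $(x{:}\tau\hookrightarrow y{:}\mu)$ (at most one per $x$, with distinct $y$'s); $\mathcal{M}(x)=y$ if $(x{:}\tau\hookrightarrow y{:}\mu)\in\mathcal{M}$ and $\mathcal{M}(x)=x$ if $x\notin\mathrm{dom}(\mathcal{M})$. Naming convention: bound variables are pairwise distinct and distinct from context variables; an image $\mathcal M(x)$ is either $x$ itself or a name not occurring in the Core program; newly introduced names are fresh. **Translation** $\mathcal{M};\bar\sigma\vdash\langle\mathsf{C};e\rangle\rightsquigarrow e'$, inductively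 defined by the rules: - SOp: if $\mathcal{M};\bar\sigma\vdash\langle\mathsf{C}[\mathtt{let}\ x{:}\tau=op(\bar y)\ \mathtt{in}\ -];e\rangle\rightsquigarrow e'$ then $\mathcal{M};\bar\sigma\vdash\langle\mathsf{C};\mathtt{let}\ x{:}\tau=op(\bar y)\ \mathtt{in}\ e\rangle\rightsquigarrow e'$. - SSlice: the same with $\mathtt{slice}\ d\ y[r_a]$ in place of $op(\bar y)$. - SYldTop: $\mathcal{M};\cdot\vdash\langle\mathsf{C};\mathtt{yield}(x)\rangle\rightsquigarrow\mathsf{C}[\mathtt{yield}(y)][\overline{\mathcal{M}(z)}/\bar z]$ where $y=\mathcal{M}(x)$, $\bar z=\mathrm{free}(\mathsf{C})$. - SYldL: if $x\in\mathrm{defs}(\mathsf{C})$, $\bar aa=\mathrm{axes}(\bar\sigma\sigma)$, $\bar z=\mathrm{free}(\mathsf{C})$: $\mathcal{M};\bar\sigma\sigma\vdash\langle\mathsf{C};\mathtt{yield}(x)\rangle\rightsquigarrow\mathtt{let}\ x'=\mathtt{execute}\ \bar aa\ \overline{\mathcal{M}(z)}\,(\lambda\bar r.\lambda\bar y.\mathsf{C}[\mathtt{yield}(x)][\bar y/\bar z])\ \mathtt{in}\ \mathtt{yield}(x')$. - SYldP: if $x\notin\mathrm{defs}(\mathsf{C})$, $\bar aa=\mathrm{axes}(\bar\sigma\sigma)$, $(x{:}\mathtt{tensor}\langle\bar n\rangle\hookrightarrow z{:}\mathtt{dtensor}\langle\bar c,\bar n\rangle)\in\mathcal{M}$, $\bar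 c\subseteq\bar a$: $\mathcal{M};\bar\sigma\sigma\vdash\langle\mathsf{C};\mathtt{yield}(x)\rangle\rightsquigarrow\mathtt{let}\ x'=\mathtt{execute}\ \bar aa\ z\,(\lambda\bar r.\lambda y.\mathtt{yield}(y))\ \mathtt{in}\ \mathtt{yield}(x')$. - SYldC: if $x\notin\mathrm{defs}(\mathsf{C})$, $\bar aa=\mathrm{axes}(\bar\sigma\sigma)$, $(x{:}\mathtt{tensor}\langle\bar n\rangle\hookrightarrow z{:}\mathtt{dtensor}\langle\bar aa,\bar n\rangle)\in\mathcal{M}$: $\mathcal{M};\bar\sigma\sigma\vdash\langle\mathsf{C};\mathtt{yield}(x)\rangle\rightsquigarrow\mathtt{yield}(z)$. - SLoop: $\mathcal{M};\bar\sigma\vdash\langle\mathsf{C};\mathtt{let}\ x{:}\tau=\mathtt{loop}_a\,\sigma\,(\lambda r_a.e_1)\ \mathtt{in}\ e_2\rangle\rightsquigarrow\mathsf{C}^{s}[\mathsf{C}^{s}_1[\mathsf{C}^{s}_*[e']]]$ provided: $\{\overline{x_\ell{:}\tau_\ell}\}$ is the set of $x_\ell{:}\tau_\ell\in\mathrm{defs}(\mathsf{C})$ with $x_\ell$ free in $e_1$ or $e_2$; $\bar a=\mathrm{axes}(\bar\sigma)$; $\bar z=\mathrm{free}(\mathsf{C})$; $\mathsf{C}^{s}=-$ if there are no such $x_\ell$, and otherwise $\mathsf{C}^{s}=\mathtt{let}\ \bar x'_\ell=\mathtt{execute}\ \bar a\ \overline{\mathcal{M}(z)}\,(\lambda\bar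 r.\lambda\bar y.\mathsf{C}[\mathtt{yield}(\bar x_\ell)][\bar y/\bar z])\ \mathtt{in}\ -$; $\mathcal{M}_1$ is $\mathcal{M}$ extended with $(x_{\ell i}{:}\mathtt{tensor}\langle\bar n_i\rangle\hookrightarrow x'_{\ell i}{:}\mathtt{dtensor}\langle\bar a,\bar n_i\rangle)$ for all $i$, where $\tau_{\ell i}=\mathtt{tensor}\langle\bar n_i\rangle$; $\mathcal{M}_1;\bar\sigma\sigma\vdash\langle-;e_1\rangle\rightsquigarrow\mathsf{C}^{s}_1[\mathtt{yield}(z)]$; with $\tau=\mathtt{tensor}\langle\bar n\rangle$ and $\mu=\mathtt{dtensor}\langle\bar a,\bar n\rangle$, $\mathsf{C}^{s}_*$ is $\mathtt{let}\ z'{:}\mu=\mathtt{tile\_reduce}\ \mathtt{sum}\langle a\rangle\ z\ \mathtt{in}\ -$ if $\sigma=\mathtt{sum}\langle a\rangle$, and $\mathtt{let}\ z_0=\mathtt{tile\_reduce}\ \mathtt{tile}\langle a,d\rangle\ z\ \mathtt{in}\ \mathtt{let}\ z'=\mathtt{redistribute}\ z_0\blacktriangleright\mu\ \mathtt{in}\ -$ if $\sigma=\mathtt{tile}\langle a,d\rangle$; and $\mathcal{M}_1,(x{:}\tau\hookrightarrow z'{:}\mu);\bar\sigma\vdash\langle-;e_2\rangle\rightsquigarrow e'$. **Compatibility.** For a Core typing context $\Gamma$, $\Gamma\vdash\mathcal{M}$ means: $\mathcal{M}$ has an entry for $x$ exactly when $x$ is a tensor variable of $\Gamma$, and for $x{:}\mathtt{tensor}\langle\bar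 m\rangle\in\Gamma$ the entry is $(x{:}\mathtt{tensor}\langle\bar m\rangle\hookrightarrow y{:}\mathtt{dtensor}\langle\bar b,\bar m\rangle)$ where $\bar b$ lists, in order, the axes of the range variables preceding $x$ in $\Gamma$. Then $\Gamma_{\mathcal{M}}$ is the SPMD typing context consisting of all $y{:}\mu$ in the image of $\mathcal{M}$, ordered as their preimages in $\Gamma$. **Environment relation.** For $\Gamma\vdash\mathcal{M}$, $\gamma\in\llbracket\Gamma\rrbracket$, $\gamma'\in\llbracket\Gamma_{\mathcal{M}}\rrbracket$: $\gamma\sim_{\mathcal{M}}\gamma'$ iff for every $(x{:}\mathtt{tensor}\langle\bar m\rangle\hookrightarrow y{:}\mathtt{dtensor}\langle b_1\cdots b_l,\bar m\rangle)\in\mathcal{M}$ one has $\gamma(x)=\gamma'(y)\,\gamma(r_{b_1})\cdots\gamma(r_{b_l})$. *)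

theory Defs
  imports "HOL-Library.FuncSet"
begin

section \<open>Meshes and arrays\<close>

text \<open>
  The range variable of an axis is unique, so it is represented by the axis itself.
  Type parameters: \<open>'v\<close> tensor variables, \<open>'a\<close> axis names, \<open>'op\<close> tensor operations,
  \<open>'r\<close> array entries (any commutative monoid, as the languages only add arrays).
  Dimension indices count from \<open>0\<close>.
\<close>

type_synonym shape = "nat list"
type_synonym 'a mesh = "'a \<rightharpoonup> nat"

definition wf_mesh :: "'a mesh \<Rightarrow> bool" where
  "wf_mesh M \<longleftrightarrow> finite (dom M) \<and> (\<forall>n\<in>ran M. 0 < n)"

definition sizes :: "'a mesh \<Rightarrow> 'a list \<Rightarrow> nat list" where
  "sizes M as = map (\<lambda>a. the (M a)) as"

definition indices :: "nat list \<Rightarrow> nat list set" where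
  "indices ns = {is. length is = length ns \<and> (\<forall>d<length ns. is ! d < ns ! d)}"

text \<open>
  Arrays carry their shape; the entry function is \<open>undefined\<close> outside the index set, so that
  equality of arrays is equality of shapes and of all entries.
\<close>

datatype 'r tensor = Tensor (shape_of: shape) (entry: "nat list \<Rightarrow> 'r")

definition tensors :: "shape \<Rightarrow> 'r tensor set" where
  "tensors ns = {A. shape_of A = ns \<and> entry A \<in> extensional (indices ns)}"

definition mk_tensor :: "shape \<Rightarrow> (nat list \<Rightarrow> 'r) \<Rightarrow> 'r tensor" where
  "mk_tensor ns f = Tensor ns (restrict f (indices ns))"

text \<open>Concatenation of \<open>A 0, \<dots>, A (n - 1)\<close>, arrays of one common shape, along dimension \<open>d\<close>.\<close>

definition tconcat :: "nat \<Rightarrow> nat \<Rightarrow> (nat \<Rightarrow> 'r tensor) \<Rightarrow> 'r tensor" where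
  "tconcat d n A =
    (let ns = shape_of (A 0); m = ns ! d
     in mk_tensor (ns[d := m * n]) (\<lambda>is. entry (A (is ! d div m)) (is[d := is ! d mod m])))"

definition tsum :: "nat \<Rightarrow> (nat \<Rightarrow> 'r::comm_monoid_add tensor) \<Rightarrow> 'r tensor" where
  "tsum n A = mk_tensor (shape_of (A 0)) (\<lambda>is. \<Sum>j<n. entry (A j) is)"

text \<open>
  The \<open>i\<close>-th of the \<open>n\<close> equal slices of \<open>A\<close> along dimension \<open>d\<close>; the slice size \<open>m\<close> is the one
  in the type of the slice, because that of \<open>A\<close> has size \<open>m * n\<close> there and \<open>n > 0\<close>.
\<close>

definition tslice :: "nat \<Rightarrow> nat \<Rightarrow> nat \<Rightarrow> 'r tensor \<Rightarrow> 'r tensor" where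
  "tslice d n i A =
    (let ns = shape_of A; m = ns ! d div n
     in mk_tensor (ns[d := m]) (\<lambda>is. entry A (is[d := i * m + is ! d])))"

text \<open>
  The tensor operations: \<open>T f nss\<close> is the result type of \<open>f\<close> on operands of types \<open>nss\<close>
  (\<open>None\<close> if there is none), \<open>F f\<close> its interpretation.
\<close>

definition wf_ops ::
  "('op \<Rightarrow> shape list \<Rightarrow> shape option) \<Rightarrow> ('op \<Rightarrow> 'r tensor list \<Rightarrow> 'r tensor) \<Rightarrow> bool" where
  "wf_ops T F \<longleftrightarrow>
    (\<forall>f nss ns As. T f nss = Some ns \<longrightarrow> list_all2 (\<lambda>A n. A \<in> tensors n) As nss \<longrightarrow> F f As \<in> tensors ns)"


section \<open>The Core language\<close>

datatype 'a action = Tile 'a nat | Sum 'a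

primrec axis :: "'a action \<Rightarrow> 'a" where
  "axis (Tile a d) = a"
| "axis (Sum a) = a"

definition axes :: "'a action list \<Rightarrow> 'a list" where
  "axes \<sigma>s = map axis \<sigma>s"

text \<open>
  \<open>Loop a \<sigma> e\<close> binds the range variable of \<open>a\<close> in \<open>e\<close>.  Expressions yield tuples because the
  bodies of \<open>execute\<close> may; a Core program proper is one whose type is a singleton list
  (the typing rules force this for loop bodies).
\<close>

datatype ('v, 'a, 'op) cval =
    Op 'op "'v list"
  | Loop 'a "'a action" "('v, 'a, 'op) cexpr"
  | Slice nat 'v 'a
and ('v, 'a, 'op) cexpr =
    Let 'v shape "('v, 'a, 'op) cval" "('v, 'a, 'op) cexpr"
  | Yield "'v list"

primrec free_val :: "('v, 'a, 'op) cval \<Rightarrow> 'v set"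
  and free :: "('v, 'a, 'op) cexpr \<Rightarrow> 'v set" where
  "free_val (Op f xs) = set xs"
| "free_val (Loop a \<sigma> e) = free e"
| "free_val (Slice d x a) = {x}"
| "free (Let x \<tau> v e) = free_val v \<union> (free e - {x})"
| "free (Yield xs) = set xs"

text \<open>Bound tensor variables, one list element per binding occurrence.\<close>

primrec bound_val :: "('v, 'a, 'op) cval \<Rightarrow> 'v list"
  and bound :: "('v, 'a, 'op) cexpr \<Rightarrow> 'v list" where
  "bound_val (Op f xs) = []"
| "bound_val (Loop a \<sigma> e) = bound e"
| "bound_val (Slice d x a) = []"
| "bound (Let x \<tau> v e) = x # bound_val v @ bound e"
| "bound (Yield xs) = []"

definition names :: "('v, 'a, 'op) cexpr \<Rightarrow> 'v set" where
  "names e = free e \<union> set (bound e)"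

text \<open>
  Simultaneous substitution for free variables.  It does not rename binders: the naming
  convention excludes capture wherever it is used.
\<close>

primrec subst_val :: "('v \<Rightarrow> 'v) \<Rightarrow> ('v, 'a, 'op) cval \<Rightarrow> ('v, 'a, 'op) cval"
  and subst :: "('v \<Rightarrow> 'v) \<Rightarrow> ('v, 'a, 'op) cexpr \<Rightarrow> ('v, 'a, 'op) cexpr" where
  "subst_val s (Op f xs) = Op f (map s xs)"
| "subst_val s (Loop a \<sigma> e) = Loop a \<sigma> (subst s e)"
| "subst_val s (Slice d x a) = Slice d (s x) a"
| "subst s (Let x \<tau> v e) = Let x \<tau> (subst_val s v) (subst (s(x := x)) e)"
| "subst s (Yield xs) = Yield (map s xs)"

definition ren :: "'v list \<Rightarrow> 'v list \<Rightarrow> 'v \<Rightarrow> 'v" where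
  "ren zs ys x = (case map_of (zip zs ys) x of None \<Rightarrow> x | Some y \<Rightarrow> y)"

subsection \<open>Typing\<close>

datatype ('v, 'a) binding = TVar 'v shape | RVar 'a

type_synonym ('v, 'a) cctx = "('v, 'a) binding list"

definition tvars :: "('v, 'a) cctx \<Rightarrow> 'v list" where
  "tvars \<Gamma> = concat (map (\<lambda>b. case b of TVar x ns \<Rightarrow> [x] | RVar a \<Rightarrow> []) \<Gamma>)"

definition rvars :: "('v, 'a) cctx \<Rightarrow> 'a list" where
  "rvars \<Gamma> = concat (map (\<lambda>b. case b of TVar x ns \<Rightarrow> [] | RVar a \<Rightarrow> [a]) \<Gamma>)"

definition wf_cctx :: "'a mesh \<Rightarrow> ('v, 'a) cctx \<Rightarrow> bool" where
  "wf_cctx M \<Gamma> \<longleftrightarrow> distinct (tvars \<Gamma>) \<and> distinct (rvars \<Gamma>) \<and> set (rvars \<Gamma>) \<subseteq> dom M"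

inductive ctyp_val ::
    "'a mesh \<Rightarrow> ('op \<Rightarrow> shape list \<Rightarrow> shape option) \<Rightarrow> ('v, 'a) cctx \<Rightarrow> ('v, 'a, 'op) cval \<Rightarrow> shape \<Rightarrow> bool"
  and ctyp ::
    "'a mesh \<Rightarrow> ('op \<Rightarrow> shape list \<Rightarrow> shape option) \<Rightarrow> ('v, 'a) cctx \<Rightarrow> ('v, 'a, 'op) cexpr \<Rightarrow> shape list \<Rightarrow> bool"
  for M T where
  ctyp_Op: "list_all2 (\<lambda>x ns. TVar x ns \<in> set \<Gamma>) xs nss \<Longrightarrow> T f nss = Some ns
    \<Longrightarrow> ctyp_val M T \<Gamma> (Op f xs) ns"
| ctyp_Tile: "ctyp M T (\<Gamma> @ [RVar a]) e [ns] \<Longrightarrow> RVar a \<notin> set \<Gamma> \<Longrightarrow> M a = Some n \<Longrightarrow> d < length ns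
    \<Longrightarrow> ctyp_val M T \<Gamma> (Loop a (Tile a d) e) (ns[d := ns ! d * n])"
| ctyp_Sum: "ctyp M T (\<Gamma> @ [RVar a]) e [ns] \<Longrightarrow> RVar a \<notin> set \<Gamma> \<Longrightarrow> a \<in> dom M
    \<Longrightarrow> ctyp_val M T \<Gamma> (Loop a (Sum a) e) ns"
| ctyp_Slice: "TVar x ns \<in> set \<Gamma> \<Longrightarrow> RVar a \<in> set \<Gamma> \<Longrightarrow> M a = Some n \<Longrightarrow> d < length ns \<Longrightarrow> ns ! d = m * n
    \<Longrightarrow> ctyp_val M T \<Gamma> (Slice d x a) (ns[d := m])"
| ctyp_Let: "ctyp_val M T \<Gamma> v \<tau> \<Longrightarrow> x \<notin> set (tvars \<Gamma>) \<Longrightarrow> ctyp M T (\<Gamma> @ [TVar x \<tau>]) e \<tau>s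
    \<Longrightarrow> ctyp M T \<Gamma> (Let x \<tau> v e) \<tau>s"
| ctyp_Yield: "list_all2 (\<lambda>x ns. TVar x ns \<in> set \<Gamma>) xs nss
    \<Longrightarrow> ctyp M T \<Gamma> (Yield xs) nss"

subsection \<open>Semantics\<close>

text \<open>
  An environment consists of its restrictions to tensor and to range variables.  As arrays
  carry their shapes, the meaning of a typing derivation depends on the term only.
\<close>

type_synonym ('v, 'a, 'r) cenv = "('v \<rightharpoonup> 'r tensor) \<times> ('a \<rightharpoonup> nat)"

definition cenvs :: "'a mesh \<Rightarrow> ('v, 'a) cctx \<Rightarrow> ('v, 'a, 'r) cenv set" where
  "cenvs M \<Gamma> = {(\<theta>, \<rho>).
      dom \<theta> = set (tvars \<Gamma>) \<and> dom \<rho> = set (rvars \<Gamma>) \<and>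
      (\<forall>x ns. TVar x ns \<in> set \<Gamma> \<longrightarrow> the (\<theta> x) \<in> tensors ns) \<and>
      (\<forall>a. RVar a \<in> set \<Gamma> \<longrightarrow> (\<exists>n. M a = Some n \<and> the (\<rho> a) < n))}"

primrec csem_val ::
    "'a mesh \<Rightarrow> ('op \<Rightarrow> 'r::comm_monoid_add tensor list \<Rightarrow> 'r tensor) \<Rightarrow>
     ('v, 'a, 'op) cval \<Rightarrow> ('v, 'a, 'r) cenv \<Rightarrow> 'r tensor"
  and csem ::
    "'a mesh \<Rightarrow> ('op \<Rightarrow> 'r::comm_monoid_add tensor list \<Rightarrow> 'r tensor) \<Rightarrow>
     ('v, 'a, 'op) cexpr \<Rightarrow> ('v, 'a, 'r) cenv \<Rightarrow> 'r tensor list" where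
  "csem_val M F (Op f xs) \<gamma> = F f (map (\<lambda>x. the (fst \<gamma> x)) xs)"
| "csem_val M F (Loop a \<sigma> e) \<gamma> =
    (case \<sigma> of
       Tile _ d \<Rightarrow> tconcat d (the (M a)) (\<lambda>i. hd (csem M F e (fst \<gamma>, (snd \<gamma>)(a \<mapsto> i))))
     | Sum _ \<Rightarrow> tsum (the (M a)) (\<lambda>i. hd (csem M F e (fst \<gamma>, (snd \<gamma>)(a \<mapsto> i)))))"
| "csem_val M F (Slice d x a) \<gamma> = tslice d (the (M a)) (the (snd \<gamma> a)) (the (fst \<gamma> x))"
| "csem M F (Let x \<tau> v e) \<gamma> = csem M F e ((fst \<gamma>)(x \<mapsto> csem_val M F v \<gamma>), snd \<gamma>)"
| "csem M F (Yield xs) \<gamma> = map (\<lambda>x. the (fst \<gamma> x)) xs"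

subsection \<open>Simple contexts\<close>

text \<open>A context is the list of the \<open>let\<close> bindings around its hole, outermost first.\<close>

type_synonym ('v, 'a, 'op) ctx = "('v \<times> shape \<times> ('v, 'a, 'op) cval) list"

definition simple :: "('v, 'a, 'op) ctx \<Rightarrow> bool" where
  "simple C \<longleftrightarrow> (\<forall>(x, \<tau>, v) \<in> set C. (\<exists>f ys. v = Op f ys) \<or> (\<exists>d y a. v = Slice d y a))"

definition fill :: "('v, 'a, 'op) ctx \<Rightarrow> ('v, 'a, 'op) cexpr \<Rightarrow> ('v, 'a, 'op) cexpr" where
  "fill C e = foldr (\<lambda>(x, \<tau>, v). Let x \<tau> v) C e"

definition defs :: "('v, 'a, 'op) ctx \<Rightarrow> ('v \<times> shape) set" where
  "defs C = (\<lambda>(x, \<tau>, v). (x, \<tau>)) ` set C"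

definition free_ctx :: "('v, 'a, 'op) ctx \<Rightarrow> 'v set" where
  "free_ctx C = free (fill C (Yield []))"


section \<open>The SPMD language\<close>

text \<open>
  A dimension \<open>{as}n\<close> is the pair \<open>(as, n)\<close>, where \<open>([], n)\<close> is the undistributed \<open>n\<close>;
  \<open>DTensor as \<rho>s\<close> has stacked axes \<open>as\<close>, and \<open>tensor\<langle>ns\<rangle>\<close> is \<open>dtensor [] ns\<close>.
\<close>

datatype 'a dtype = DTensor (stacked: "'a list") (dims: "('a list \<times> nat) list")

definition dtensor :: "'a list \<Rightarrow> shape \<Rightarrow> 'a dtype" where
  "dtensor as ns = DTensor as (map (Pair []) ns)"

text \<open>The last axis of a distributed dimension is divided out first.\<close>

definition local_dim :: "'a mesh \<Rightarrow> 'a list \<times> nat \<Rightarrow> nat" where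
  "local_dim M \<rho> = foldr (\<lambda>a k. k div the (M a)) (fst \<rho>) (snd \<rho>)"

definition local_shape :: "'a mesh \<Rightarrow> 'a dtype \<Rightarrow> shape" where
  "local_shape M \<mu> = map (local_dim M) (dims \<mu>)"

definition global_shape :: "'a dtype \<Rightarrow> shape" where
  "global_shape \<mu> = map snd (dims \<mu>)"

text \<open>\<open>Execute as xs ys e\<close> binds the range variables of \<open>as\<close> and the tensor variables \<open>ys\<close> in \<open>e\<close>.\<close>

datatype ('v, 'a, 'op) sval =
    SOp 'op "'v list"
  | Execute "'a list" "'v list" "'v list" "('v, 'a, 'op) cexpr"
  | Redistribute 'v "'a dtype"
  | TileReduce "'a action" 'v

datatype ('v, 'a, 'op) sexpr =
    SLet "('v \<times> 'a dtype) list" "('v, 'a, 'op) sval" "('v, 'a, 'op) sexpr"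
  | SYield "'v list"

type_synonym ('v, 'a) sctxt = "('v \<times> 'a dtype) list"

subsection \<open>Typing\<close>

inductive styp_val ::
    "'a mesh \<Rightarrow> ('op \<Rightarrow> shape list \<Rightarrow> shape option) \<Rightarrow>
     ('v, 'a) sctxt \<Rightarrow> ('v, 'a, 'op) sval \<Rightarrow> 'a dtype list \<Rightarrow> bool"
  for M T where
  styp_Op: "list_all2 (\<lambda>x ns. (x, dtensor [] ns) \<in> set \<Gamma>) xs nss \<Longrightarrow> T f nss = Some ns
    \<Longrightarrow> styp_val M T \<Gamma> (SOp f xs) [dtensor [] ns]"
| styp_Execute: "list_all2 (\<lambda>x \<mu>. (x, \<mu>) \<in> set \<Gamma>) xs \<mu>s \<Longrightarrow> length ys = length xs
    \<Longrightarrow> \<Delta> = map RVar as @ map2 TVar ys (map (local_shape M) \<mu>s) \<Longrightarrow> wf_cctx M \<Delta>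
    \<Longrightarrow> ctyp M T \<Delta> e nss
    \<Longrightarrow> styp_val M T \<Gamma> (Execute as xs ys e) (map (dtensor as) nss)"
| styp_Redistribute: "(x, \<mu>1) \<in> set \<Gamma> \<Longrightarrow> stacked \<mu>1 = stacked \<mu>2 \<Longrightarrow> global_shape \<mu>1 = global_shape \<mu>2
    \<Longrightarrow> styp_val M T \<Gamma> (Redistribute x \<mu>2) [\<mu>2]"
| styp_Sum: "(x, DTensor (as @ [a]) \<rho>s) \<in> set \<Gamma>
    \<Longrightarrow> styp_val M T \<Gamma> (TileReduce (Sum a) x) [DTensor as \<rho>s]"
| styp_Tile: "(x, DTensor (as @ [a]) \<rho>s) \<in> set \<Gamma> \<Longrightarrow> d < length \<rho>s \<Longrightarrow> \<rho>s ! d = (cs, m) \<Longrightarrow> M a = Some n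
    \<Longrightarrow> styp_val M T \<Gamma> (TileReduce (Tile a d) x) [DTensor as (\<rho>s[d := (cs @ [a], m * n)])]"

inductive styp ::
    "'a mesh \<Rightarrow> ('op \<Rightarrow> shape list \<Rightarrow> shape option) \<Rightarrow>
     ('v, 'a) sctxt \<Rightarrow> ('v, 'a, 'op) sexpr \<Rightarrow> 'a dtype list \<Rightarrow> bool"
  for M T where
  styp_Let: "styp_val M T \<Gamma> v (map snd bs) \<Longrightarrow> distinct (map fst bs) \<Longrightarrow> fst ` set bs \<inter> fst ` set \<Gamma> = {}
    \<Longrightarrow> styp M T (\<Gamma> @ bs) e \<mu>s \<Longrightarrow> styp M T \<Gamma> (SLet bs v e) \<mu>s"
| styp_Yield: "list_all2 (\<lambda>x \<mu>. (x, \<mu>) \<in> set \<Gamma>) xs \<mu>s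
    \<Longrightarrow> styp M T \<Gamma> (SYield xs) \<mu>s"

subsection \<open>Semantics\<close>

text \<open>
  Iterated function spaces are uncurried: an element of the interpretation of
  \<open>dtensor\<langle>a1\<cdots>ak, ns\<rangle>\<close> maps \<open>[i1, \<dots>, ik]\<close> to an array and is \<open>undefined\<close> off its domain.
  Distribution axes are further arguments after the stacked ones.
\<close>

type_synonym 'r dval = "nat list \<Rightarrow> 'r tensor"

definition dvals :: "'a mesh \<Rightarrow> 'a dtype \<Rightarrow> 'r dval set" where
  "dvals M \<mu> = (indices (sizes M (stacked \<mu> @ concat (map fst (dims \<mu>)))) \<rightarrow>\<^sub>E tensors (local_shape M \<mu>))"

type_synonym ('v, 'r) senv = "'v \<rightharpoonup> 'r dval"

definition senvs :: "'a mesh \<Rightarrow> ('v, 'a) sctxt \<Rightarrow> ('v, 'r) senv set" where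
  "senvs M \<Gamma> = {\<gamma>. dom \<gamma> = fst ` set \<Gamma> \<and> (\<forall>(x, \<mu>) \<in> set \<Gamma>. the (\<gamma> x) \<in> dvals M \<mu>)}"

primrec arity :: "('v, 'a, 'op) cexpr \<Rightarrow> nat" where
  "arity (Let x \<tau> v e) = arity e"
| "arity (Yield xs) = length xs"

definition type_of :: "('v, 'a) sctxt \<Rightarrow> 'v \<Rightarrow> 'a dtype" where
  "type_of \<Gamma> x = the (map_of \<Gamma> x)"

text \<open>
  Values denote tuples, as lists.  \<open>redistribute\<close> has a meaning only if exactly one dimension of
  its operand is distributed, by exactly one axis, and it removes that distribution.
\<close>

primrec ssem_val ::
    "'a mesh \<Rightarrow> ('op \<Rightarrow> 'r::comm_monoid_add tensor list \<Rightarrow> 'r tensor) \<Rightarrow>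
     ('v, 'a) sctxt \<Rightarrow> ('v, 'a, 'op) sval \<Rightarrow> ('v, 'r) senv \<Rightarrow> 'r dval list" where
  "ssem_val M F \<Gamma> (SOp f xs) \<gamma> =
    [\<lambda>is\<in>indices []. F f (map (\<lambda>x. the (\<gamma> x) []) xs)]"
| "ssem_val M F \<Gamma> (Execute as xs ys e) \<gamma> =
    map (\<lambda>j. \<lambda>is\<in>indices (sizes M as).
        csem M F e
          (map_of (zip ys (map (\<lambda>x. the (\<gamma> x) (take (length (stacked (type_of \<Gamma> x))) is)) xs)),
           map_of (zip as is)) ! j)
      [0..<arity e]"
| "ssem_val M F \<Gamma> (Redistribute x \<mu>) \<gamma> =
    (let as = stacked (type_of \<Gamma> x); \<rho>s = dims (type_of \<Gamma> x)
     in case filter (\<lambda>d. fst (\<rho>s ! d) \<noteq> []) [0..<length \<rho>s] of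
          [d] \<Rightarrow>
            (case fst (\<rho>s ! d) of
               [a] \<Rightarrow> if \<mu> = dtensor as (global_shape (type_of \<Gamma> x))
                      then [\<lambda>is\<in>indices (sizes M as). tconcat d (the (M a)) (\<lambda>j. the (\<gamma> x) (is @ [j]))]
                      else undefined
             | _ \<Rightarrow> undefined)
        | _ \<Rightarrow> undefined)"
| "ssem_val M F \<Gamma> (TileReduce \<sigma> x) \<gamma> =
    (let as = butlast (stacked (type_of \<Gamma> x))
     in case \<sigma> of
          Sum a \<Rightarrow> [\<lambda>is\<in>indices (sizes M as). tsum (the (M a)) (\<lambda>j. the (\<gamma> x) (is @ [j]))]
        | Tile a d \<Rightarrow> [\<lambda>is\<in>indices (sizes M (as @ [a])). the (\<gamma> x) is])"

primrec ssem ::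
    "'a mesh \<Rightarrow> ('op \<Rightarrow> 'r::comm_monoid_add tensor list \<Rightarrow> 'r tensor) \<Rightarrow>
     ('v, 'a) sctxt \<Rightarrow> ('v, 'a, 'op) sexpr \<Rightarrow> ('v, 'r) senv \<Rightarrow> 'r dval list" where
  "ssem M F \<Gamma> (SLet bs v e) \<gamma> = ssem M F (\<Gamma> @ bs) e (\<gamma>(map fst bs [\<mapsto>] ssem_val M F \<Gamma> v \<gamma>))"
| "ssem M F \<Gamma> (SYield xs) \<gamma> = map (\<lambda>x. the (\<gamma> x)) xs"

subsection \<open>SPMD contexts\<close>

type_synonym ('v, 'a, 'op) sctx = "(('v \<times> 'a dtype) list \<times> ('v, 'a, 'op) sval) list"

definition sfill :: "('v, 'a, 'op) sctx \<Rightarrow> ('v, 'a, 'op) sexpr \<Rightarrow> ('v, 'a, 'op) sexpr" where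
  "sfill Cs e = foldr (\<lambda>(bs, v). SLet bs v) Cs e"

primrec sbound_val :: "('v, 'a, 'op) sval \<Rightarrow> 'v set" where
  "sbound_val (SOp f xs) = {}"
| "sbound_val (Execute as xs ys e) = set ys \<union> set (bound e)"
| "sbound_val (Redistribute x \<mu>) = {}"
| "sbound_val (TileReduce \<sigma> x) = {}"

definition sbound_ctx :: "('v, 'a, 'op) sctx \<Rightarrow> 'v set" where
  "sbound_ctx Cs = (\<Union>(bs, v) \<in> set Cs. fst ` set bs \<union> sbound_val v)"


section \<open>The translation\<close>

text \<open>An entry \<open>((x, ns), (y, \<mu>))\<close> stands for \<open>x : tensor\<langle>ns\<rangle> \<hookrightarrow> y : \<mu>\<close>.\<close>

type_synonym ('v, 'a) vmap = "(('v \<times> shape) \<times> ('v \<times> 'a dtype)) list"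

definition vdom :: "('v, 'a) vmap \<Rightarrow> 'v list" where
  "vdom \<M> = map (\<lambda>((x, ns), (y, \<mu>)). x) \<M>"

definition vimg :: "('v, 'a) vmap \<Rightarrow> 'v list" where
  "vimg \<M> = map (\<lambda>((x, ns), (y, \<mu>)). y) \<M>"

definition wf_vmap :: "('v, 'a) vmap \<Rightarrow> bool" where
  "wf_vmap \<M> \<longleftrightarrow> distinct (vdom \<M>) \<and> distinct (vimg \<M>)"

definition vapp :: "('v, 'a) vmap \<Rightarrow> 'v \<Rightarrow> 'v" where
  "vapp \<M> = ren (vdom \<M>) (vimg \<M>)"

text \<open>
  The Core expressions that are also SPMD expressions: those without loops and slices, with
  \<open>tensor\<langle>ns\<rangle>\<close> read as \<open>dtensor [] ns\<close>.
\<close>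

inductive core_as_spmd :: "('v, 'a, 'op) cexpr \<Rightarrow> ('v, 'a, 'op) sexpr \<Rightarrow> bool" where
  "core_as_spmd (Yield xs) (SYield xs)"
| "core_as_spmd e e' \<Longrightarrow> core_as_spmd (Let x \<tau> (Op f ys) e) (SLet [(x, dtensor [] \<tau>)] (SOp f ys) e')"

text \<open>
  \<open>trans_avoid N \<M> \<sigma>s C e e'\<close> is \<open>\<M>; \<sigma>s \<turnstile> \<langle>C; e\<rangle> \<leadsto> e'\<close> where all newly introduced names are
  pairwise distinct and outside \<open>N\<close>.  Sets such as \<open>free(C)\<close> are listed without repetition in an
  arbitrary order, and introduced \<open>let\<close>s carry the types that the typing rules assign.
\<close>

inductive trans_avoid ::
    "'v set \<Rightarrow> ('v, 'a) vmap \<Rightarrow> 'a action list \<Rightarrow> ('v, 'a, 'op) ctx \<Rightarrow>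
     ('v, 'a, 'op) cexpr \<Rightarrow> ('v, 'a, 'op) sexpr \<Rightarrow> bool" where
  TOp:
    "trans_avoid N \<M> \<sigma>s (C @ [(x, \<tau>, Op f ys)]) e e'
     \<Longrightarrow> trans_avoid N \<M> \<sigma>s C (Let x \<tau> (Op f ys) e) e'"
| TSlice:
    "trans_avoid N \<M> \<sigma>s (C @ [(x, \<tau>, Slice d y a)]) e e'
     \<Longrightarrow> trans_avoid N \<M> \<sigma>s C (Let x \<tau> (Slice d y a) e) e'"
| TYldTop:
    "\<lbrakk> distinct zs; set zs = free_ctx C; y = vapp \<M> x;
       core_as_spmd (subst (ren zs (map (vapp \<M>) zs)) (fill C (Yield [y]))) e' \<rbrakk>
     \<Longrightarrow> trans_avoid N \<M> [] C (Yield [x]) e'"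
| TYldL:
    "\<lbrakk> (x, ns) \<in> defs C; as = axes (\<sigma>s @ [\<sigma>]); distinct zs; set zs = free_ctx C;
       length ys = length zs; distinct (x' # ys); set (x' # ys) \<inter> N = {};
       v = Execute as (map (vapp \<M>) zs) ys (subst (ren zs ys) (fill C (Yield [x]))) \<rbrakk>
     \<Longrightarrow> trans_avoid N \<M> (\<sigma>s @ [\<sigma>]) C (Yield [x]) (SLet [(x', dtensor as ns)] v (SYield [x']))"
| TYldP:
    "\<lbrakk> x \<notin> fst ` defs C; as = axes (\<sigma>s @ [\<sigma>]);
       ((x, ns), (z, dtensor cs ns)) \<in> set \<M>; set cs \<subseteq> set (axes \<sigma>s);
       x' \<noteq> y; x' \<notin> N; y \<notin> N;
       v = Execute as [z] [y] (Yield [y]) \<rbrakk>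
     \<Longrightarrow> trans_avoid N \<M> (\<sigma>s @ [\<sigma>]) C (Yield [x]) (SLet [(x', dtensor as ns)] v (SYield [x']))"
| TYldC:
    "\<lbrakk> x \<notin> fst ` defs C; as = axes (\<sigma>s @ [\<sigma>]);
       ((x, ns), (z, dtensor as ns)) \<in> set \<M> \<rbrakk>
     \<Longrightarrow> trans_avoid N \<M> (\<sigma>s @ [\<sigma>]) C (Yield [x]) (SYield [z])"
| TLoop:
    "\<lbrakk> distinct ls; set ls = {(x, \<tau>) \<in> defs C. x \<in> free e1 \<union> free e2};
       as = axes \<sigma>s; distinct zs; set zs = free_ctx C;
       length ls' = length ls; distinct ls'; set ls' \<inter> N = {};
       bs = map2 (\<lambda>x' (x, ns). (x', dtensor as ns)) ls' ls;
       if ls = [] then Cs = []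
       else \<exists>ys. length ys = length zs \<and> distinct ys \<and> set ys \<inter> (N \<union> set ls') = {} \<and>
         Cs = [(bs, Execute as (map (vapp \<M>) zs) ys (subst (ren zs ys) (fill C (Yield (map fst ls)))))];
       N1 = N \<union> sbound_ctx Cs;
       \<M>1 = \<M> @ zip ls bs;
       trans_avoid N1 \<M>1 (\<sigma>s @ [\<sigma>]) [] e1 (sfill Cs1 (SYield [z]));
       N2 = N1 \<union> sbound_ctx Cs1;
       \<mu> = dtensor as ns;
       z' \<notin> N2;
       case \<sigma> of
         Sum b \<Rightarrow> Cs2 = [([(z', \<mu>)], TileReduce (Sum b) z)]
       | Tile b d \<Rightarrow> \<exists>z0. z0 \<notin> N2 \<and> z0 \<noteq> z' \<and>
           Cs2 = [([(z0, DTensor as ((map (Pair []) ns)[d := ([b], ns ! d)]))], TileReduce (Tile b d) z),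
                  ([(z', \<mu>)], Redistribute z0 \<mu>)];
       N3 = N2 \<union> sbound_ctx Cs2;
       trans_avoid N3 (\<M>1 @ [((x, ns), (z', \<mu>))]) \<sigma>s [] e2 e' \<rbrakk>
     \<Longrightarrow> trans_avoid N \<M> \<sigma>s C (Let x ns (Loop a \<sigma> e1) e2) (sfill Cs (sfill Cs1 (sfill Cs2 e')))"

text \<open>New names are fresh for the Core program and for the variable map.\<close>

definition translates ::
    "('v, 'a) vmap \<Rightarrow> 'a action list \<Rightarrow> ('v, 'a, 'op) ctx \<Rightarrow>
     ('v, 'a, 'op) cexpr \<Rightarrow> ('v, 'a, 'op) sexpr \<Rightarrow> bool" where
  "translates \<M> \<sigma>s C e e' \<longleftrightarrow>
    trans_avoid (names (fill C e) \<union> set (vdom \<M>) \<union> set (vimg \<M>)) \<M> \<sigma>s C e e'"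

text \<open>
  The naming convention for the given data: bound variables are pairwise distinct and distinct
  from context variables, and each image under \<open>\<M>\<close> is the variable itself or a name that does
  not occur in the Core program.
\<close>

definition naming_convention ::
    "('v, 'a) cctx \<Rightarrow> ('v, 'a) vmap \<Rightarrow> ('v, 'a, 'op) cexpr \<Rightarrow> bool" where
  "naming_convention \<Gamma> \<M> p \<longleftrightarrow>
    distinct (tvars \<Gamma> @ bound p) \<and>
    (\<forall>((x, ns), (y, \<mu>)) \<in> set \<M>. y = x \<or> y \<notin> names p)"

definition compatible :: "('v, 'a) cctx \<Rightarrow> ('v, 'a) vmap \<Rightarrow> bool" where
  "compatible \<Gamma> \<M> \<longleftrightarrow>
    wf_vmap \<M> \<and> set (vdom \<M>) = set (tvars \<Gamma>) \<and>
    (\<forall>\<Gamma>1 x ms \<Gamma>2. \<Gamma> = \<Gamma>1 @ TVar x ms # \<Gamma>2 \<longrightarrow>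
       (\<exists>y. ((x, ms), (y, dtensor (rvars \<Gamma>1) ms)) \<in> set \<M>))"

definition spmd_ctxt :: "('v, 'a) cctx \<Rightarrow> ('v, 'a) vmap \<Rightarrow> ('v, 'a) sctxt" where
  "spmd_ctxt \<Gamma> \<M> = concat (map (\<lambda>x. [(y, \<mu>). ((x', ns), (y, \<mu>)) \<leftarrow> \<M>, x' = x]) (tvars \<Gamma>))"

definition env_rel :: "('v, 'a) vmap \<Rightarrow> ('v, 'a, 'r) cenv \<Rightarrow> ('v, 'r) senv \<Rightarrow> bool" where
  "env_rel \<M> \<gamma> \<gamma>' \<longleftrightarrow>
    (\<forall>((x, ms), (y, \<mu>)) \<in> set \<M>.
       the (fst \<gamma> x) = the (\<gamma>' y) (map (\<lambda>b. the (snd \<gamma> b)) (stacked \<mu>)))"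

end

theory Submission
  imports Defs
begin

text \<open>
  Induction on the translation derivation.  The statement does not survive the loop rule: the
  bindings emitted for the loop body stay in scope of the translation of the continuation, while
  the variables bound by the simple context are translated only if they are used later.  So the
  induction is over an arbitrary Core context \<open>\<Gamma>\<close> of which \<open>\<M>\<close> covers the free variables of
  the program, and an arbitrary SPMD context \<open>\<Delta>\<close> extending the image of \<open>\<M>\<close>.  An emitted
  \<open>execute\<close> replays the simple context at one point of the stacked axes, since the stacked
  axes of every image are a prefix of the range variables in scope.  For a loop, the induction
  hypothesis of the body, at a single SPMD environment, is used once for each value of the
  loop's range variable, and \<open>tile_reduce\<close> (with \<open>redistribute\<close>) combines these values.
\<close>

section \<open>Core expressions\<close>

text \<open>Typing and meaning are proved in one induction, because \<open>ssem\<close> looks up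
  operand types in the SPMD context: what an emitted \<open>tile_reduce\<close> denotes is known
  only after the translated body has been typed and its names found distinct. The prefix condition
  cannot be replaced by inclusion of axes: \<open>execute\<close> hands an operand the initial
  indices, and only for a prefix are these the range values at which \<open>env_rel\<close> reads
  the image. The hypothesis of a loop body can be used at one SPMD environment for all values of the
  range variable, since no image in scope is stacked along the axis of that loop, so that changing
  this value preserves \<open>env_rel\<close>. As \<open>subst\<close> does not rename binders,
  capture has to be excluded each time. This is the task of the set \<open>N\<close>: it contains
  the names of the program and of the SPMD context, grows with every emitted binding, and every new
  name is chosen outside it.\<close>

lemma tvars_simps [simp]:
  "tvars [] = []" "tvars (\<Gamma> @ \<Gamma>') = tvars \<Gamma> @ tvars \<Gamma>'"
  "tvars (TVar x ns # \<Gamma>) = x # tvars \<Gamma>" "tvars (RVar a # \<Gamma>) = tvars \<Gamma>"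
  by (simp_all add: tvars_def)

lemma rvars_simps [simp]:
  "rvars [] = []" "rvars (\<Gamma> @ \<Gamma>') = rvars \<Gamma> @ rvars \<Gamma>'"
  "rvars (TVar x ns # \<Gamma>) = rvars \<Gamma>" "rvars (RVar a # \<Gamma>) = a # rvars \<Gamma>"
  by (simp_all add: rvars_def)

lemma in_set_tvars: "x \<in> set (tvars \<Gamma>) \<longleftrightarrow> (\<exists>ns. TVar x ns \<in> set \<Gamma>)"
proof (induction \<Gamma>)
  case (Cons b \<Gamma>)
  then show ?case by (cases b) auto
qed simp

lemma in_set_rvars: "a \<in> set (rvars \<Gamma>) \<longleftrightarrow> RVar a \<in> set \<Gamma>"
proof (induction \<Gamma>)
  case (Cons b \<Gamma>)
  then show ?case by (cases b) auto
qed simp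

lemma fill_simps [simp]:
  "fill [] e = e" "fill ((x, \<tau>, v) # C) e = Let x \<tau> v (fill C e)"
  "fill (C @ C') e = fill C (fill C' e)"
  by (simp_all add: fill_def)

lemma defs_simps [simp]:
  "defs [] = {}" "defs ((x, \<tau>, v) # C) = insert (x, \<tau>) (defs C)"
  "defs (C @ C') = defs C \<union> defs C'"
  by (simp_all add: defs_def image_Un)

lemma free_fill: "free (fill C e) = free_ctx C \<union> (free e - fst ` defs C)"
proof (induction C)
  case (Cons b C)
  obtain x \<tau> v where b: "b = (x, \<tau>, v)" by (cases b) auto
  have "free_ctx (b # C) = free_val v \<union> (free_ctx C - {x})"
    by (simp add: free_ctx_def b)
  then show ?case using Cons by (auto simp: b)
qed (simp add: free_ctx_def)

lemma simple_simps [simp]: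
  "simple []" "simple ((x, \<tau>, v) # C) \<longleftrightarrow> ((\<exists>f ys. v = Op f ys) \<or> (\<exists>d y a. v = Slice d y a)) \<and> simple C"
  "simple (C @ C') \<longleftrightarrow> simple C \<and> simple C'"
  by (simp_all add: simple_def ball_Un)

lemma bound_fill_simple: "simple C \<Longrightarrow> bound (fill C e) = map fst C @ bound e"
proof (induction C)
  case (Cons b C)
  obtain x \<tau> v where b: "b = (x, \<tau>, v)" by (cases b) auto
  show ?case using Cons by (auto simp: b)
qed simp

lemma fst_defs: "fst ` defs C = set (map fst C)"
  by (force simp: defs_def)

lemma arity_fill [simp]: "arity (fill C e) = arity e"
  by (induction C) auto

lemma arity_subst [simp]: "arity (subst s e) = arity e"
  by (induction e arbitrary: s rule: cexpr.induct[where ?P1.0 = "\<lambda>_. True"]) auto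

lemma bound_subst [simp]: "bound (subst s e) = bound e"
  by (induction e arbitrary: s
      rule: cexpr.induct[where ?P1.0 = "\<lambda>v. \<forall>s. bound_val (subst_val s v) = bound_val v"]) auto

lemma length_csem: "length (csem M F e \<gamma>) = arity e"
  by (induction e arbitrary: \<gamma> rule: cexpr.induct[where ?P1.0 = "\<lambda>_. True"]) auto

section \<open>Renaming and simultaneous substitution\<close>

lemma ren_nth:
  assumes "distinct zs" "length ys = length zs" "i < length zs"
  shows "ren zs ys (zs ! i) = ys ! i"
proof -
  have "map_of (zip zs ys) (zs ! i) = Some (ys ! i)"
    using assms by (simp add: map_of_zip_nth)
  then show ?thesis by (simp add: ren_def)
qed

lemma ren_notin: "length ys = length zs \<Longrightarrow> z \<notin> set zs \<Longrightarrow> ren zs ys z = z"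
  by (auto simp: ren_def split: option.split dest: map_of_SomeD set_zip_leftD)

lemma ren_map:
  assumes "z \<in> set zs"
  shows "ren zs (map f zs) z = f z"
  using assms by (simp add: ren_def map_of_zip_map)

lemma
  fixes v :: "('v, 'a, 'op) cval" and e :: "('v, 'a, 'op) cexpr"
  shows subst_val_cong: "(\<And>z. z \<in> free_val v \<Longrightarrow> s z = t z) \<Longrightarrow> subst_val s v = subst_val t v"
    and subst_cong: "(\<And>z. z \<in> free e \<Longrightarrow> s z = t z) \<Longrightarrow> subst s e = subst t e"
proof (induction v and e arbitrary: s t and s t)
  case (Loop a \<sigma> e)
  have "subst s e = subst t e" by (rule Loop.IH) (simp add: Loop.prems)
  then show ?case by simp
next
  case (Let x \<tau> v e)
  have "subst_val s v = subst_val t v" by (rule Let.IH(1)) (simp add: Let.prems)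
  moreover have "subst (s(x := x)) e = subst (t(x := x)) e"
    by (rule Let.IH(2)) (simp add: Let.prems)
  ultimately show ?case by simp
qed simp_all

text \<open>The expressions in the hole may differ: at top level the translation puts the already
  renamed variable into the hole before it substitutes, and this is to be compared with a renaming
  of the original program. Variables defined by \<open>C\<close> are protected when the substitution
  reaches the hole, hence the identity on them.\<close>

lemma subst_fill_cong:
  assumes "\<And>z. z \<in> free_ctx C \<Longrightarrow> s z = t z"
    and "subst (\<lambda>z. if z \<in> fst ` defs C then z else s z) e
       = subst (\<lambda>z. if z \<in> fst ` defs C then z else t z) e'"
  shows "subst s (fill C e) = subst t (fill C e')"
  using assms
proof (induction C arbitrary: s t)
  case (Cons b C)
  obtain x \<tau> v where b: "b = (x, \<tau>, v)" by (cases b) auto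
  have fr: "free_ctx (b # C) = free_val v \<union> (free_ctx C - {x})"
    by (simp add: free_ctx_def b)
  have "subst_val s v = subst_val t v"
    using Cons.prems(1) by (intro subst_val_cong) (simp add: fr)
  moreover have "subst (s(x := x)) (fill C e) = subst (t(x := x)) (fill C e')"
  proof (rule Cons.IH)
    have *: "(\<lambda>z. if z \<in> fst ` defs C then z else (u(x := x)) z)
        = (\<lambda>z. if z \<in> fst ` defs (b # C) then z else u z)" for u :: "'a \<Rightarrow> 'a"
      by (auto simp: b fun_eq_iff)
    show "subst (\<lambda>z. if z \<in> fst ` defs C then z else (s(x := x)) z) e
        = subst (\<lambda>z. if z \<in> fst ` defs C then z else (t(x := x)) z) e'"
      unfolding * by (rule Cons.prems(2))
  qed (use Cons.prems(1) fr in auto)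
  ultimately show ?case by (simp add: b)
qed simp

text \<open>Since binders are kept, the images of free variables must miss the bound ones.
  Distinctness of the binders carries this condition under a \<open>let\<close>, where the bound
  variable becomes its own image. Environments are compared through \<open>the\<close>, so their
  domains may differ.\<close>

lemma csem_val_subst:
    "\<lbrakk>\<And>z. z \<in> free_val v \<Longrightarrow> the (\<theta>' (s z)) = the (\<theta> z); s ` free_val v \<inter> set (bound_val v) = {}; distinct (bound_val v)\<rbrakk>
     \<Longrightarrow> csem_val M F (subst_val s v) (\<theta>', \<rho>) = csem_val M F v (\<theta>, \<rho>)"
  and csem_subst:
    "\<lbrakk>\<And>z. z \<in> free e \<Longrightarrow> the (\<theta>' (s z)) = the (\<theta> z); s ` free e \<inter> set (bound e) = {}; distinct (bound e)\<rbrakk>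
     \<Longrightarrow> csem M F (subst s e) (\<theta>', \<rho>) = csem M F e (\<theta>, \<rho>)"
proof (induction v and e arbitrary: s \<theta> \<theta>' \<rho> and s \<theta> \<theta>' \<rho>)
  case (Op f xs)
  then show ?case by (auto intro!: arg_cong[where f = "F f"])
next
  case (Loop a \<sigma> e)
  have "csem M F (subst s e) (\<theta>', \<rho>(a \<mapsto> i)) = csem M F e (\<theta>, \<rho>(a \<mapsto> i))" for i
    by (rule Loop.IH) (use Loop.prems in auto)
  then show ?case by (simp split: action.split)
next
  case (Let x \<tau> v e)
  have v: "csem_val M F (subst_val s v) (\<theta>', \<rho>) = csem_val M F v (\<theta>, \<rho>)"
    by (rule Let.IH(1)) (use Let.prems in auto)
  have "csem M F (subst (s(x := x)) e) (\<theta>'(x \<mapsto> A), \<rho>) = csem M F e (\<theta>(x \<mapsto> A), \<rho>)" for A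
  proof (rule Let.IH(2))
    fix z assume z: "z \<in> free e"
    show "the ((\<theta>'(x \<mapsto> A)) ((s(x := x)) z)) = the ((\<theta>(x \<mapsto> A)) z)"
    proof (cases "z = x")
      case False
      \<comment> \<open>No capture: binding \<open>x\<close> leaves the value at the image of any
        other variable unchanged.\<close>
      then have "s z \<noteq> x" using Let.prems(2) z by auto
      then show ?thesis using False Let.prems(1) z by simp
    qed simp
  next
    show "(s(x := x)) ` free e \<inter> set (bound e) = {}"
      using Let.prems(2,3) by auto
  qed (use Let.prems(3) in simp)
  then show ?case by (simp add: v)
qed auto

text \<open>This serves also to change the context: \<open>\<Gamma>'\<close> has to contain the free
  variables of the program under their new names, in any order. The range variables must coincide as
  sets, because a slice needs its own to be present and a loop needs its own to be absent.\<close>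

lemma ctyp_val_subst:
    "\<lbrakk>ctyp_val M T \<Gamma> v \<tau>; \<And>z ns. z \<in> free_val v \<Longrightarrow> TVar z ns \<in> set \<Gamma> \<Longrightarrow> TVar (s z) ns \<in> set \<Gamma>';
      set (rvars \<Gamma>') = set (rvars \<Gamma>); set (bound_val v) \<inter> set (tvars \<Gamma>') = {}; distinct (bound_val v)\<rbrakk>
     \<Longrightarrow> ctyp_val M T \<Gamma>' (subst_val s v) \<tau>"
  and ctyp_subst:
    "\<lbrakk>ctyp M T \<Gamma> e \<tau>s; \<And>z ns. z \<in> free e \<Longrightarrow> TVar z ns \<in> set \<Gamma> \<Longrightarrow> TVar (s z) ns \<in> set \<Gamma>';
      set (rvars \<Gamma>') = set (rvars \<Gamma>); set (bound e) \<inter> set (tvars \<Gamma>') = {}; distinct (bound e)\<rbrakk>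
     \<Longrightarrow> ctyp M T \<Gamma>' (subst s e) \<tau>s"
proof (induction arbitrary: s \<Gamma>' and s \<Gamma>' rule: ctyp_val_ctyp.inducts)
  case (ctyp_Op \<Gamma> xs nss f ns)
  have "list_all2 (\<lambda>x ns. TVar x ns \<in> set \<Gamma>') (map s xs) nss"
    using ctyp_Op by (auto simp: list_all2_conv_all_nth)
  then show ?case using ctyp_Op by (auto intro: ctyp_val_ctyp.ctyp_Op)
next
  case (ctyp_Tile \<Gamma> a e ns n d)
  have "ctyp M T (\<Gamma>' @ [RVar a]) (subst s e) [ns]"
    by (rule ctyp_Tile.IH) (use ctyp_Tile.prems in auto)
  moreover have "RVar a \<notin> set \<Gamma>'"
    using ctyp_Tile.hyps ctyp_Tile.prems(2) by (metis in_set_rvars)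
  ultimately show ?case
    using \<open>M a = Some n\<close> \<open>d < length ns\<close> by (auto intro: ctyp_val_ctyp.ctyp_Tile)
next
  case (ctyp_Sum \<Gamma> a e ns)
  have "ctyp M T (\<Gamma>' @ [RVar a]) (subst s e) [ns]"
    by (rule ctyp_Sum.IH) (use ctyp_Sum.prems in auto)
  moreover have "RVar a \<notin> set \<Gamma>'"
    using ctyp_Sum.hyps ctyp_Sum.prems(2) by (metis in_set_rvars)
  ultimately show ?case
    using \<open>a \<in> dom M\<close> by (auto intro: ctyp_val_ctyp.ctyp_Sum)
next
  case (ctyp_Slice x ns \<Gamma> a n d m)
  have "RVar a \<in> set \<Gamma>'"
    using ctyp_Slice.hyps ctyp_Slice.prems(2) by (metis in_set_rvars)
  moreover have "TVar (s x) ns \<in> set \<Gamma>'"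
    using ctyp_Slice by simp
  ultimately show ?case
    using \<open>M a = Some n\<close> \<open>d < length ns\<close> \<open>ns ! d = m * n\<close>
    by (auto intro: ctyp_val_ctyp.ctyp_Slice)
next
  case (ctyp_Let \<Gamma> v \<tau> x e \<tau>s)
  have "ctyp_val M T \<Gamma>' (subst_val s v) \<tau>"
    by (rule ctyp_Let.IH) (use ctyp_Let.prems in auto)
  moreover have "ctyp M T (\<Gamma>' @ [TVar x \<tau>]) (subst (s(x := x)) e) \<tau>s"
    by (rule ctyp_Let.IH) (use ctyp_Let.prems ctyp_Let.hyps in \<open>auto simp: in_set_tvars\<close>)
  ultimately show ?case
    using ctyp_Let.prems by (auto intro!: ctyp_val_ctyp.ctyp_Let)
next
  case (ctyp_Yield \<Gamma> xs nss)
  have "list_all2 (\<lambda>x ns. TVar x ns \<in> set \<Gamma>') (map s xs) nss"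
    using ctyp_Yield by (auto simp: list_all2_conv_all_nth)
  from ctyp_val_ctyp.ctyp_Yield[OF this] show ?case by simp
qed

lemma ctyp_val_free: "ctyp_val M T \<Gamma> v \<tau> \<Longrightarrow> free_val v \<subseteq> set (tvars \<Gamma>)"
  and ctyp_free: "ctyp M T \<Gamma> e \<tau>s \<Longrightarrow> free e \<subseteq> set (tvars \<Gamma>)"
proof (induction rule: ctyp_val_ctyp.inducts)
  case (ctyp_Op \<Gamma> xs nss f ns)
  then show ?case by (fastforce simp: in_set_tvars list_all2_conv_all_nth set_conv_nth[of xs])
next
  case (ctyp_Yield \<Gamma> xs nss)
  then show ?case by (fastforce simp: in_set_tvars list_all2_conv_all_nth set_conv_nth[of xs])
qed (auto simp: in_set_tvars)

inductive_cases ctyp_LetE: "ctyp M T \<Gamma> (Let x \<tau> v e) \<tau>s"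
inductive_cases ctyp_YieldE: "ctyp M T \<Gamma> (Yield xs) \<tau>s"
inductive_cases ctyp_LoopE: "ctyp_val M T \<Gamma> (Loop a \<sigma> e) \<tau>"

section \<open>Simple contexts and typed environments\<close>

definition ctx_bindings :: "('v, 'a, 'op) ctx \<Rightarrow> ('v, 'a) cctx" where
  "ctx_bindings C = map (\<lambda>(x, \<tau>, v). TVar x \<tau>) C"

lemma ctx_bindings_simps [simp]:
  "ctx_bindings [] = []" "ctx_bindings ((x, \<tau>, v) # C) = TVar x \<tau> # ctx_bindings C"
  by (simp_all add: ctx_bindings_def)

lemma tvars_ctx_bindings [simp]: "set (tvars (ctx_bindings C)) = fst ` defs C"
proof (induction C)
  case (Cons b C)
  then show ?case by (cases b) simp
qed simp

lemma rvars_ctx_bindings [simp]: "rvars (ctx_bindings C) = []"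
  by (induction C) auto

lemma TVar_in_ctx_bindings: "TVar x \<tau> \<in> set (ctx_bindings C) \<longleftrightarrow> (x, \<tau>) \<in> defs C"
  by (induction C) auto

lemma RVar_in_ctx_bindings [simp]: "RVar a \<notin> set (ctx_bindings C)"
  by (simp flip: in_set_rvars)

lemma ctyp_fillD: "ctyp M T \<Gamma> (fill C e) \<tau>s \<Longrightarrow> ctyp M T (\<Gamma> @ ctx_bindings C) e \<tau>s"
proof (induction C arbitrary: \<Gamma>)
  case (Cons b C)
  then show ?case by (cases b) (fastforce elim!: ctyp_LetE)
qed simp

text \<open>The bindings of \<open>C\<close> are typed independently of what stands in the hole, so
  \<open>C\<close> can be replayed around a \<open>yield\<close> of variables that it
  defines.\<close>

lemma ctyp_fill_replace:
  "ctyp M T \<Gamma> (fill C e) \<tau>s \<Longrightarrow> ctyp M T (\<Gamma> @ ctx_bindings C) e' \<tau>s' \<Longrightarrow> ctyp M T \<Gamma> (fill C e') \<tau>s'"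
proof (induction C arbitrary: \<Gamma>)
  case (Cons b C)
  then show ?case by (cases b) (fastforce elim!: ctyp_LetE intro: ctyp_Let)
qed simp

text \<open>There is no condition on the domain, as values are read through \<open>the\<close>, and
  none on range variables, as they do not influence shapes.\<close>

definition typed_env :: "('v, 'a) cctx \<Rightarrow> ('v \<rightharpoonup> 'r tensor) \<Rightarrow> bool" where
  "typed_env \<Gamma> \<theta> \<longleftrightarrow> (\<forall>x ns. TVar x ns \<in> set \<Gamma> \<longrightarrow> the (\<theta> x) \<in> tensors ns)"

lemma typed_env_Let:
  "typed_env \<Gamma> \<theta> \<Longrightarrow> A \<in> tensors \<tau> \<Longrightarrow> x \<notin> set (tvars \<Gamma>) \<Longrightarrow> typed_env (\<Gamma> @ [TVar x \<tau>]) (\<theta>(x \<mapsto> A))"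
  by (auto simp: typed_env_def in_set_tvars)

lemma typed_env_RVar [simp]: "typed_env (\<Gamma> @ [RVar a]) \<theta> = typed_env \<Gamma> \<theta>"
  by (auto simp: typed_env_def)

lemma mk_tensor_in_tensors: "mk_tensor ns f \<in> tensors ns"
  by (simp add: mk_tensor_def tensors_def)

lemma wf_mesh_pos: "wf_mesh M \<Longrightarrow> M a = Some n \<Longrightarrow> 0 < n"
  by (auto simp: wf_mesh_def ran_def)

text \<open>Shapes enter the meaning of loops: \<open>tconcat\<close> and \<open>tsum\<close> take
  theirs from the array at index \<open>0\<close>. The loop cases therefore need the body at
  \<open>0\<close> only.\<close>

lemma csem_val_in_tensors:
    "\<lbrakk>ctyp_val M T \<Gamma> v \<tau>; wf_mesh M; wf_ops T F; typed_env \<Gamma> (fst \<gamma>)\<rbrakk>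
     \<Longrightarrow> csem_val M F v \<gamma> \<in> tensors \<tau>"
  and csem_in_tensors:
    "\<lbrakk>ctyp M T \<Gamma> e \<tau>s; wf_mesh M; wf_ops T F; typed_env \<Gamma> (fst \<gamma>)\<rbrakk>
     \<Longrightarrow> list_all2 (\<lambda>A n. A \<in> tensors n) (csem M F e \<gamma>) \<tau>s"
proof (induction arbitrary: \<gamma> and \<gamma> rule: ctyp_val_ctyp.inducts)
  case (ctyp_Op \<Gamma> xs nss f ns)
  have "list_all2 (\<lambda>A n. A \<in> tensors n) (map (\<lambda>x. the (fst \<gamma> x)) xs) nss"
    using ctyp_Op by (auto simp: list_all2_conv_all_nth typed_env_def)
  then show ?case using ctyp_Op by (auto simp: wf_ops_def)
next
  case (ctyp_Tile \<Gamma> a e ns n d)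
  have "list_all2 (\<lambda>A n. A \<in> tensors n) (csem M F e (fst \<gamma>, (snd \<gamma>)(a \<mapsto> 0))) [ns]"
    by (rule ctyp_Tile.IH) (use ctyp_Tile.prems in auto)
  then have "shape_of (hd (csem M F e (fst \<gamma>, (snd \<gamma>)(a \<mapsto> 0)))) = ns"
    by (auto simp: list_all2_Cons2 tensors_def)
  then show ?case using ctyp_Tile by (simp add: tconcat_def Let_def mk_tensor_in_tensors)
next
  case (ctyp_Sum \<Gamma> a e ns)
  have "list_all2 (\<lambda>A n. A \<in> tensors n) (csem M F e (fst \<gamma>, (snd \<gamma>)(a \<mapsto> 0))) [ns]"
    by (rule ctyp_Sum.IH) (use ctyp_Sum.prems in auto)
  then have "shape_of (hd (csem M F e (fst \<gamma>, (snd \<gamma>)(a \<mapsto> 0)))) = ns"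
    by (auto simp: list_all2_Cons2 tensors_def)
  then show ?case using ctyp_Sum by (simp add: tsum_def mk_tensor_in_tensors)
next
  case (ctyp_Slice x ns \<Gamma> a n d m)
  have "shape_of (the (fst \<gamma> x)) = ns"
    using ctyp_Slice by (auto simp: typed_env_def tensors_def)
  moreover have "the (M a) = n" using \<open>M a = Some n\<close> by simp
  \<comment> \<open>The division recovers the slice size because axes have positive size.\<close>
  then have "ns ! d div the (M a) = m"
    using \<open>ns ! d = m * n\<close> wf_mesh_pos[OF \<open>wf_mesh M\<close> \<open>M a = Some n\<close>] by simp
  ultimately show ?case by (simp add: tslice_def Let_def mk_tensor_in_tensors)
next
  case (ctyp_Let \<Gamma> v \<tau> x e \<tau>s)
  then show ?case by (simp add: typed_env_Let)
next
  case (ctyp_Yield \<Gamma> xs nss)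
  then show ?case by (auto simp: list_all2_conv_all_nth typed_env_def)
qed

primrec ctx_env ::
    "'a mesh \<Rightarrow> ('op \<Rightarrow> 'r::comm_monoid_add tensor list \<Rightarrow> 'r tensor) \<Rightarrow>
     ('v, 'a, 'op) ctx \<Rightarrow> ('v, 'a, 'r) cenv \<Rightarrow> ('v, 'a, 'r) cenv" where
  "ctx_env M F [] \<gamma> = \<gamma>"
| "ctx_env M F (b # C) \<gamma> =
    ctx_env M F C ((fst \<gamma>)(fst b \<mapsto> csem_val M F (snd (snd b)) \<gamma>), snd \<gamma>)"

lemma csem_fill: "csem M F (fill C e) \<gamma> = csem M F e (ctx_env M F C \<gamma>)"
  by (induction C arbitrary: \<gamma>) auto

lemma snd_ctx_env [simp]: "snd (ctx_env M F C \<gamma>) = snd \<gamma>"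
  by (induction C arbitrary: \<gamma>) auto

lemma fst_ctx_env_notin: "x \<notin> fst ` defs C \<Longrightarrow> fst (ctx_env M F C \<gamma>) x = fst \<gamma> x"
  by (induction C arbitrary: \<gamma>) auto

lemma typed_env_ctx_env:
  "\<lbrakk>ctyp M T \<Gamma> (fill C e) \<tau>s; wf_mesh M; wf_ops T F; typed_env \<Gamma> (fst \<gamma>)\<rbrakk>
   \<Longrightarrow> typed_env (\<Gamma> @ ctx_bindings C) (fst (ctx_env M F C \<gamma>))"
proof (induction C arbitrary: \<Gamma> \<gamma>)
  case (Cons b C)
  obtain x \<tau> v where b: "b = (x, \<tau>, v)" by (cases b) auto
  from Cons.prems(1) have v: "ctyp_val M T \<Gamma> v \<tau>" and x: "x \<notin> set (tvars \<Gamma>)"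
    and e: "ctyp M T (\<Gamma> @ [TVar x \<tau>]) (fill C e) \<tau>s"
    by (auto simp: b elim: ctyp_LetE)
  have "typed_env (\<Gamma> @ [TVar x \<tau>]) ((fst \<gamma>)(x \<mapsto> csem_val M F v \<gamma>))"
    by (intro typed_env_Let csem_val_in_tensors[OF v] x Cons.prems)
  from Cons.IH[OF e Cons.prems(2,3), of "((fst \<gamma>)(x \<mapsto> csem_val M F v \<gamma>), snd \<gamma>)"] this
  show ?case by (simp add: b fun_upd_def)
qed simp

section \<open>Congruence for sums and concatenations of arrays\<close>

lemma tsum_cong:
  assumes "\<And>j. j < n \<Longrightarrow> A j = B j" "0 < n"
  shows "tsum n A = tsum n B"
  using assms by (simp add: tsum_def mk_tensor_def)

text \<open>The shape is read at \<open>0\<close>, so \<open>n\<close> must be positive for the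
  families to agree there. That \<open>d\<close> is a dimension of the blocks is what makes the
  index set bound the block number by \<open>n\<close>.\<close>

lemma tconcat_cong:
  assumes "\<And>j. j < n \<Longrightarrow> A j = B j" "0 < n" "d < length (shape_of (A 0))"
  shows "tconcat d n A = tconcat d n B"
proof -
  define ns where "ns = shape_of (A 0)"
  have "A (is ! d div (ns ! d)) = B (is ! d div (ns ! d))"
    if "is \<in> indices (ns[d := ns ! d * n])" for "is"
  proof -
    have "is ! d < ns ! d * n" using that assms(3) by (auto simp: indices_def ns_def)
    then show ?thesis by (intro assms(1)) (simp add: less_mult_imp_div_less mult.commute)
  qed
  moreover have "shape_of (B 0) = ns" using assms by (simp add: ns_def)
  ultimately show ?thesis
    by (auto simp: tconcat_def mk_tensor_def Let_def ns_def[symmetric] intro!: restrict_ext)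
qed

section \<open>SPMD expressions\<close>

lemma sfill_simps [simp]: "sfill [] e = e" "sfill ((bs, v) # Cs) e = SLet bs v (sfill Cs e)"
  by (simp_all add: sfill_def)

lemma sbound_ctx_simps [simp]:
  "sbound_ctx [] = {}" "sbound_ctx ((bs, v) # Cs) = fst ` set bs \<union> sbound_val v \<union> sbound_ctx Cs"
  by (auto simp: sbound_ctx_def)

definition sctx_bindings :: "('v, 'a, 'op) sctx \<Rightarrow> ('v, 'a) sctxt" where
  "sctx_bindings Cs = concat (map fst Cs)"

lemma sctx_bindings_simps [simp]:
  "sctx_bindings [] = []" "sctx_bindings ((bs, v) # Cs) = bs @ sctx_bindings Cs"
  by (simp_all add: sctx_bindings_def)

lemma sctx_bindings_sbound: "fst ` set (sctx_bindings Cs) \<subseteq> sbound_ctx Cs"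
proof (induction Cs)
  case (Cons b Cs)
  then show ?case by (cases b) auto
qed simp

section \<open>SPMD contexts: typing, distinct names, evaluation\<close>

inductive_cases styp_SLetE: "styp M T \<Delta> (SLet bs v e) \<mu>s"
inductive_cases styp_SYieldE: "styp M T \<Delta> (SYield xs) \<mu>s"

lemma styp_sfillD: "styp M T \<Delta> (sfill Cs e) \<mu>s \<Longrightarrow> styp M T (\<Delta> @ sctx_bindings Cs) e \<mu>s"
proof (induction Cs arbitrary: \<Delta>)
  case (Cons b Cs)
  then show ?case by (cases b) (fastforce elim!: styp_SLetE)
qed simp

lemma styp_sfill_replace:
  "styp M T \<Delta> (sfill Cs e) \<mu>s \<Longrightarrow> styp M T (\<Delta> @ sctx_bindings Cs) e' \<mu>s'
   \<Longrightarrow> styp M T \<Delta> (sfill Cs e') \<mu>s'"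
proof (induction Cs arbitrary: \<Delta>)
  case (Cons b Cs)
  then show ?case by (cases b) (fastforce elim!: styp_SLetE intro: styp_Let)
qed simp

lemma styp_sfill_distinct:
  "styp M T \<Delta> (sfill Cs e) \<mu>s \<Longrightarrow> distinct (map fst \<Delta>) \<Longrightarrow> distinct (map fst (\<Delta> @ sctx_bindings Cs))"
proof (induction Cs arbitrary: \<Delta>)
  case (Cons b Cs)
  obtain bs v where b: "b = (bs, v)" by (cases b)
  from Cons.prems(1) have "styp M T (\<Delta> @ bs) (sfill Cs e) \<mu>s" "distinct (map fst (\<Delta> @ bs))"
    using Cons.prems(2) by (auto simp: b elim!: styp_SLetE)
  from Cons.IH[OF this] show ?case by (simp add: b)
qed simp

primrec sctx_env ::
    "'a mesh \<Rightarrow> ('op \<Rightarrow> 'r::comm_monoid_add tensor list \<Rightarrow> 'r tensor) \<Rightarrow>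
     ('v, 'a) sctxt \<Rightarrow> ('v, 'a, 'op) sctx \<Rightarrow> ('v, 'r) senv \<Rightarrow> ('v, 'r) senv" where
  "sctx_env M F \<Delta> [] \<gamma> = \<gamma>"
| "sctx_env M F \<Delta> (b # Cs) \<gamma> =
    sctx_env M F (\<Delta> @ fst b) Cs (\<gamma>(map fst (fst b) [\<mapsto>] ssem_val M F \<Delta> (snd b) \<gamma>))"

lemma ssem_sfill:
  "ssem M F \<Delta> (sfill Cs e) \<gamma> = ssem M F (\<Delta> @ sctx_bindings Cs) e (sctx_env M F \<Delta> Cs \<gamma>)"
proof (induction Cs arbitrary: \<Delta> \<gamma>)
  case (Cons b Cs)
  then show ?case by (cases b) simp
qed simp

lemma sctx_env_notin: "x \<notin> fst ` set (sctx_bindings Cs) \<Longrightarrow> sctx_env M F \<Delta> Cs \<gamma> x = \<gamma> x"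
proof (induction Cs arbitrary: \<Delta> \<gamma>)
  case (Cons b Cs)
  then show ?case by (cases b) (simp add: image_Un)
qed simp

text \<open>Only the \<open>let\<close> spine counts: unlike \<open>sbound_ctx\<close>, this omits
  the parameters and local variables of \<open>execute\<close> bodies, which the continuation cannot
  see.\<close>

primrec slet_bound :: "('v, 'a, 'op) sexpr \<Rightarrow> 'v set" where
  "slet_bound (SLet bs v e) = fst ` set bs \<union> slet_bound e"
| "slet_bound (SYield xs) = {}"

lemma slet_bound_sfill [simp]:
  "slet_bound (sfill Cs e) = fst ` set (sctx_bindings Cs) \<union> slet_bound e"
proof (induction Cs)
  case (Cons b Cs)
  then show ?case by (cases b) auto
qed simp

lemma type_of_eq: "distinct (map fst \<Delta>) \<Longrightarrow> (x, \<mu>) \<in> set \<Delta> \<Longrightarrow> type_of \<Delta> x = \<mu>"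
  by (simp add: type_of_def)

lemma dtensor_simps [simp]:
  "stacked (dtensor as ns) = as" "global_shape (dtensor as ns) = ns"
  "local_shape M (dtensor as ns) = ns" "dtensor as ns = dtensor bs ms \<longleftrightarrow> as = bs \<and> ns = ms"
proof -
  have inj: "map (Pair []) ns = map (Pair []) ms \<longleftrightarrow> ns = ms"
    by (rule inj_map_eq_map) (simp add: inj_def)
  show "stacked (dtensor as ns) = as" "global_shape (dtensor as ns) = ns"
    "dtensor as ns = dtensor bs ms \<longleftrightarrow> as = bs \<and> ns = ms"
    by (simp_all add: dtensor_def global_shape_def comp_def inj)
  show "local_shape M (dtensor as ns) = ns"
    by (simp add: dtensor_def local_shape_def comp_def local_dim_def)
qed

text \<open>\<open>\<Gamma>\<close> sees exactly the entries of \<open>\<Delta>\<close> that are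
  neither stacked nor distributed. The binders must nevertheless avoid all of
  \<open>\<Delta>\<close>, because an SPMD \<open>let\<close> rejects every name bound
  there.\<close>

lemma core_as_spmd_styp:
  "\<lbrakk>core_as_spmd p e'; ctyp M T \<Gamma> p nss; \<And>x ns. TVar x ns \<in> set \<Gamma> \<longleftrightarrow> (x, dtensor [] ns) \<in> set \<Delta>;
    set (bound p) \<inter> fst ` set \<Delta> = {}; distinct (bound p)\<rbrakk>
   \<Longrightarrow> styp M T \<Delta> e' (map (dtensor []) nss)"
proof (induction arbitrary: \<Gamma> \<Delta> rule: core_as_spmd.induct)
  case (1 xs)
  then show ?case by (auto elim!: ctyp_YieldE intro!: styp_Yield simp: list_all2_conv_all_nth)
next
  case (2 e e' x \<tau> f ys)
  from "2.prems"(1) have v: "ctyp_val M T \<Gamma> (Op f ys) \<tau>"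
    and e: "ctyp M T (\<Gamma> @ [TVar x \<tau>]) e nss"
    by (auto elim: ctyp_LetE)
  have "styp M T (\<Delta> @ [(x, dtensor [] \<tau>)]) e' (map (dtensor []) nss)"
    by (rule "2.IH"[OF e]) (use "2.prems" in auto)
  moreover have "styp_val M T \<Delta> (SOp f ys) [dtensor [] \<tau>]"
    using v "2.prems"(2)
    by (auto elim!: ctyp_val.cases intro: styp_Op)
  ultimately show ?case using "2.prems" by (intro styp_Let) auto
qed

text \<open>Without stacked axes the index list is empty, so reading each SPMD value at
  \<open>[]\<close> turns the SPMD environment into a Core environment.\<close>

lemma core_as_spmd_sem:
  "core_as_spmd p e' \<Longrightarrow>
   map (\<lambda>f. f []) (ssem M F \<Delta> e' \<gamma>') = csem M F p (\<lambda>x. Some (the (\<gamma>' x) []), \<rho>)"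
proof (induction arbitrary: \<Delta> \<gamma>' rule: core_as_spmd.induct)
  case (2 e e' x \<tau> f ys)
  have "(\<lambda>y. Some (the ((\<gamma>'(x \<mapsto> g)) y) [])) = (\<lambda>y. Some (the (\<gamma>' y) []))(x \<mapsto> g [])" for g
    by (auto simp: fun_eq_iff)
  then show ?case using "2.IH" by (simp add: indices_def)
qed simp

section \<open>Invariants of the translation\<close>

text \<open>
  Only the free variables of \<open>p\<close> need an entry in \<open>\<M>\<close>, and \<open>\<Delta>\<close> may bind more than the image
  of \<open>\<M>\<close>: below a translated loop, \<open>\<Gamma>\<close> and \<open>\<Delta>\<close> contain all bindings made so far.
\<close>

locale coherent =
  fixes M :: "'a mesh" and N :: "'v set" and \<M> :: "('v, 'a) vmap"
    and \<Gamma> :: "('v, 'a) cctx" and \<Delta> :: "('v, 'a) sctxt" and p :: "('v, 'a, 'op) cexpr"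
  assumes distinct_rvars: "distinct (rvars \<Gamma>)"
    and rvars_dom: "set (rvars \<Gamma>) \<subseteq> dom M"
    and distinct_bound: "distinct (bound p)"
    and bound_tvars: "set (bound p) \<inter> set (tvars \<Gamma>) = {}"
    and names_N: "names p \<subseteq> N"
    and distinct_vdom: "distinct (vdom \<M>)"
    and vdom_tvars: "set (vdom \<M>) \<subseteq> set (tvars \<Gamma>)"
    and covered: "\<And>x ms. x \<in> free p \<Longrightarrow> TVar x ms \<in> set \<Gamma> \<Longrightarrow>
      \<exists>y bs. ((x, ms), (y, dtensor bs ms)) \<in> set \<M> \<and> take (length bs) (rvars \<Gamma>) = bs"
    and image_names: "\<And>x ms y \<mu>. ((x, ms), (y, \<mu>)) \<in> set \<M> \<Longrightarrow> y = x \<or> y \<notin> names p"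
    and image_\<Delta>: "\<And>x ms y \<mu>. ((x, ms), (y, \<mu>)) \<in> set \<M> \<Longrightarrow> (y, \<mu>) \<in> set \<Delta>"
    and image_stacked: "\<And>x ms y \<mu>. ((x, ms), (y, \<mu>)) \<in> set \<M> \<Longrightarrow> set (stacked \<mu>) \<subseteq> set (rvars \<Gamma>)"
    and distinct_\<Delta>: "distinct (map fst \<Delta>)"
    and \<Delta>_N: "fst ` set \<Delta> \<subseteq> N"
    and \<Delta>_bound: "fst ` set \<Delta> \<inter> set (bound p) = {}"

text \<open>The range part must have exactly the domain given by \<open>\<Gamma>\<close>:
  \<open>execute\<close> rebuilds it from a list of indices, and the result has to be the original
  map.\<close>

definition valid_env :: "'a mesh \<Rightarrow> ('v, 'a) cctx \<Rightarrow> ('v, 'a, 'r) cenv \<Rightarrow> bool" where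
  "valid_env M \<Gamma> \<gamma> \<longleftrightarrow> typed_env \<Gamma> (fst \<gamma>) \<and> dom (snd \<gamma>) = set (rvars \<Gamma>) \<and>
    (\<forall>a\<in>set (rvars \<Gamma>). the (snd \<gamma> a) < the (M a))"

lemma valid_env_indices:
  "valid_env M \<Gamma> \<gamma> \<Longrightarrow> map (\<lambda>a. the (snd \<gamma> a)) (rvars \<Gamma>) \<in> indices (sizes M (rvars \<Gamma>))"
  by (auto simp: valid_env_def indices_def sizes_def)

section \<open>Lookup through a variable map\<close>

lemma in_vdom: "((x, ms), (y, \<mu>)) \<in> set \<M> \<Longrightarrow> x \<in> set (vdom \<M>)"
  by (force simp: vdom_def)

lemma vapp_eq:
  assumes "distinct (vdom \<M>)" "((x, ms), (y, \<mu>)) \<in> set \<M>"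
  shows "vapp \<M> x = y"
proof -
  obtain i where i: "i < length \<M>" "\<M> ! i = ((x, ms), (y, \<mu>))"
    using assms(2) by (metis in_set_conv_nth)
  then have "vdom \<M> ! i = x" "vimg \<M> ! i = y" by (simp_all add: vdom_def vimg_def)
  with ren_nth[OF assms(1), of "vimg \<M>" i] i show ?thesis
    by (simp add: vapp_def vdom_def vimg_def)
qed

lemma vapp_notin: "x \<notin> set (vdom \<M>) \<Longrightarrow> vapp \<M> x = x"
  by (simp add: vapp_def ren_notin vdom_def vimg_def)

lemma (in coherent) covered_vapp:
  assumes "x \<in> free p" "TVar x ms \<in> set \<Gamma>"
  obtains bs where "((x, ms), (vapp \<M> x, dtensor bs ms)) \<in> set \<M>" "take (length bs) (rvars \<Gamma>) = bs"
    "type_of \<Delta> (vapp \<M> x) = dtensor bs ms" "(vapp \<M> x, dtensor bs ms) \<in> set \<Delta>"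
  using covered[OF assms] vapp_eq[OF distinct_vdom] image_\<Delta> type_of_eq[OF distinct_\<Delta>] by metis

lemma tvars_RVars [simp]: "tvars (map RVar as) = []"
  by (induction as) auto

lemma rvars_RVars [simp]: "rvars (map RVar as) = as"
  by (induction as) auto

lemma tvars_TVars [simp]: "length ys = length nss \<Longrightarrow> tvars (map2 TVar ys nss) = ys"
  by (induction ys nss rule: list_induct2) auto

lemma rvars_TVars [simp]: "rvars (map2 TVar ys nss) = []"
proof (induction ys arbitrary: nss)
  case (Cons y ys)
  then show ?case by (cases nss) auto
qed simp

lemma env_relD:
  "env_rel \<M> \<gamma> \<gamma>' \<Longrightarrow> ((x, ms), (y, \<mu>)) \<in> set \<M> \<Longrightarrow>
   the (fst \<gamma> x) = the (\<gamma>' y) (map (\<lambda>b. the (snd \<gamma> b)) (stacked \<mu>))"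
  by (force simp: env_rel_def)

lemma env_rel_entry:
  "env_rel \<M> \<gamma> \<gamma>' \<Longrightarrow> ((x, ms), (y, dtensor bs ms)) \<in> set \<M> \<Longrightarrow>
   the (\<gamma>' y) (map (\<lambda>b. the (snd \<gamma> b)) bs) = the (fst \<gamma> x)"
  by (drule (1) env_relD) simp

text \<open>Such an \<open>execute\<close> is emitted both for the yield of a locally defined
  variable and in front of a loop, with one or several results. As \<open>C\<close> defines all of
  \<open>xs\<close>, the free variables of the replayed program are exactly \<open>zs\<close>, whose
  images are passed as operands.\<close>

lemma (in coherent) execute_context:
  assumes p: "p = fill C e" and C: "simple C" and ty: "ctyp M T \<Gamma> (fill C (Yield xs)) nss"
    and xs: "set xs \<subseteq> fst ` defs C"
    and zs: "distinct zs" "set zs = free_ctx C"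
    and ys: "length ys = length zs" "distinct ys" "set ys \<inter> N = {}"
    and v: "v = Execute (rvars \<Gamma>) (map (vapp \<M>) zs) ys (subst (ren zs ys) (fill C (Yield xs)))"
  shows execute_context_styp: "styp_val M T \<Delta> v (map (dtensor (rvars \<Gamma>)) nss)"
    and execute_context_sem: "valid_env M \<Gamma> \<gamma> \<Longrightarrow> env_rel \<M> \<gamma> \<gamma>' \<Longrightarrow>
      map (\<lambda>f. f (map (\<lambda>a. the (snd \<gamma> a)) (rvars \<Gamma>))) (ssem_val M F \<Delta> v \<gamma>')
        = csem M F (fill C (Yield xs)) \<gamma>"
proof -
  have free: "free (fill C (Yield xs)) = set zs"
    using xs by (auto simp: free_fill zs)
  have zs_free: "set zs \<subseteq> free p" by (auto simp: p free_fill zs)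
  have bound: "set (bound (fill C (Yield xs))) \<subseteq> set (bound p)"
    and dist: "distinct (bound (fill C (Yield xs)))"
    using distinct_bound by (auto simp: p bound_fill_simple[OF C])
  have bound_N: "set (bound p) \<subseteq> N" using names_N by (auto simp: names_def)
  have typed: "\<exists>ms. TVar z ms \<in> set \<Gamma>" if "z \<in> set zs" for z
    using ctyp_free[OF ty] that by (auto simp: free in_set_tvars)
  have ren: "ren zs ys (zs ! i) = ys ! i" if "i < length zs" for i
    using zs ys that by (simp add: ren_nth)
  define \<mu>s where "\<mu>s = map (\<lambda>z. type_of \<Delta> (vapp \<M> z)) zs"
  define \<Delta>' where "\<Delta>' = map RVar (rvars \<Gamma>) @ map2 TVar ys (map (local_shape M) \<mu>s)"
  have len: "length ys = length (map (local_shape M) \<mu>s)" by (simp add: ys \<mu>s_def)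
  have "list_all2 (\<lambda>x \<mu>. (x, \<mu>) \<in> set \<Delta>) (map (vapp \<M>) zs) \<mu>s"
  proof -
    have "(vapp \<M> z, type_of \<Delta> (vapp \<M> z)) \<in> set \<Delta>" if "z \<in> set zs" for z
      using typed[OF that] covered_vapp zs_free that by (metis subsetD)
    then show ?thesis by (simp add: \<mu>s_def list_all2_conv_all_nth)
  qed
  moreover have "wf_cctx M \<Delta>'"
    using distinct_rvars rvars_dom ys by (simp add: wf_cctx_def \<Delta>'_def tvars_TVars[OF len])
  moreover have "ctyp M T \<Delta>' (subst (ren zs ys) (fill C (Yield xs))) nss"
  proof (rule ctyp_subst[OF ty])
    fix z ns assume z: "z \<in> free (fill C (Yield xs))" "TVar z ns \<in> set \<Gamma>"
    then obtain i where i: "i < length zs" "z = zs ! i" by (auto simp: free in_set_conv_nth)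
    obtain bs where "type_of \<Delta> (vapp \<M> z) = dtensor bs ns"
      using covered_vapp[of z ns] z zs_free free by blast
    \<comment> \<open>Images may be stacked but are not distributed, so their local shape is the
      Core shape.\<close>
    then have "map (local_shape M) \<mu>s ! i = ns" using i by (simp add: \<mu>s_def)
    then have "TVar (ys ! i) ns \<in> set (map2 TVar ys (map (local_shape M) \<mu>s))"
      using i ys by (force simp: set_zip \<mu>s_def)
    then show "TVar (ren zs ys z) ns \<in> set \<Delta>'"
      unfolding \<Delta>'_def i(2) ren[OF i(1)] set_append by (rule UnI2)
  qed (use bound bound_N dist ys in \<open>auto simp: \<Delta>'_def tvars_TVars[OF len]\<close>)
  ultimately show "styp_val M T \<Delta> v (map (dtensor (rvars \<Gamma>)) nss)"
    unfolding v by (intro styp_Execute[OF _ _ \<Delta>'_def]) (simp_all add: ys)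
  assume valid: "valid_env M \<Gamma> \<gamma>" and rel: "env_rel \<M> \<gamma> \<gamma>'"
  define is0 where "is0 = map (\<lambda>a. the (snd \<gamma> a)) (rvars \<Gamma>)"
  define A where "A x = the (\<gamma>' x) (take (length (stacked (type_of \<Delta> x))) is0)" for x
  have \<rho>: "map_of (zip (rvars \<Gamma>) is0) = snd \<gamma>"
  proof
    fix a
    have "a \<in> set (rvars \<Gamma>) \<longleftrightarrow> snd \<gamma> a \<noteq> None"
      using valid by (metis domIff valid_env_def)
    then show "map_of (zip (rvars \<Gamma>) is0) a = snd \<gamma> a"
      by (auto simp: is0_def map_of_zip_map)
  qed
  have "csem M F (subst (ren zs ys) (fill C (Yield xs))) (map_of (zip ys (map A (map (vapp \<M>) zs))), snd \<gamma>)
      = csem M F (fill C (Yield xs)) (fst \<gamma>, snd \<gamma>)"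
  proof (rule csem_subst)
    fix z assume "z \<in> free (fill C (Yield xs))"
    then have z: "z \<in> set zs" by (simp add: free)
    then obtain i where i: "i < length zs" "z = zs ! i" by (auto simp: in_set_conv_nth)
    obtain ms where "TVar z ms \<in> set \<Gamma>" using typed[OF z] by blast
    then obtain bs where bs: "((z, ms), (vapp \<M> z, dtensor bs ms)) \<in> set \<M>"
      "take (length bs) (rvars \<Gamma>) = bs" "type_of \<Delta> (vapp \<M> z) = dtensor bs ms"
      using covered_vapp[of z ms] z zs_free by blast
    \<comment> \<open>By the prefix property, taking as many indices as there are stacked axes gives
      the range values at which \<open>env_rel\<close> relates the environments.\<close>
    have "A (vapp \<M> z) = the (fst \<gamma> z)"
      using env_rel_entry[OF rel bs(1)] bs by (simp add: A_def is0_def take_map)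
    moreover have "map_of (zip ys (map A (map (vapp \<M>) zs))) (ys ! i) = Some (A (vapp \<M> z))"
      using ys i by (subst map_of_zip_nth) auto
    ultimately show "the (map_of (zip ys (map A (map (vapp \<M>) zs))) (ren zs ys z)) = the (fst \<gamma> z)"
      using i by (simp add: ren)
  next
    \<comment> \<open>The parameters \<open>ys\<close> lie outside \<open>N\<close> and the binders
      of the program inside, so no renamed variable is captured.\<close>
    have "ren zs ys ` set zs \<subseteq> set ys"
      using ys ren by (auto simp: set_conv_nth[of zs])
    then show "ren zs ys ` free (fill C (Yield xs)) \<inter> set (bound (fill C (Yield xs))) = {}"
      using ys bound bound_N by (auto simp: free)
  qed (rule dist)
  moreover have "is0 \<in> indices (sizes M (rvars \<Gamma>))"
    using valid_env_indices[OF valid] by (simp add: is0_def)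
  moreover have "length (csem M F (fill C (Yield xs)) \<gamma>) = length xs" by (simp add: length_csem)
  ultimately have "map (\<lambda>f. f is0) (ssem_val M F \<Delta> v \<gamma>') = map ((!) (csem M F (fill C (Yield xs)) \<gamma>)) [0..<length xs]"
    by (simp add: v \<rho> A_def comp_def)
  also have "\<dots> = csem M F (fill C (Yield xs)) \<gamma>"
    by (rule nth_equalityI) (simp_all add: length_csem)
  finally show "map (\<lambda>f. f (map (\<lambda>a. the (snd \<gamma> a)) (rvars \<Gamma>))) (ssem_val M F \<Delta> v \<gamma>')
        = csem M F (fill C (Yield xs)) \<gamma>"
    by (simp add: is0_def)
qed

section \<open>Coherence and relatedness past a simple context\<close>

lemma defs_unique:
  assumes "distinct (map fst C)" "(x, \<tau>) \<in> defs C" "(x, \<tau>') \<in> defs C"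
  shows "\<tau> = \<tau>'"
  using assms by (auto simp: defs_def dest: eq_key_imp_eq_value)

lemma map2_entry:
  assumes "length ls' = length ls"
  shows "((x, ms), (y, \<mu>)) \<in> set (zip ls (map2 (\<lambda>x' (x, ns). (x', dtensor as ns)) ls' ls)) \<longleftrightarrow>
    (\<exists>i<length ls. ls ! i = (x, ms) \<and> ls' ! i = y \<and> \<mu> = dtensor as ms)"
  unfolding in_set_conv_nth using assms by (auto simp: case_prod_unfold) blast

lemma map2_keys:
  "length ls' = length ls \<Longrightarrow> map fst (map2 (\<lambda>x' (x, ns). (x', dtensor as ns)) ls' ls) = ls'"
  by (induction ls' ls rule: list_induct2) auto

lemma names_fill: "simple C \<Longrightarrow> names e \<subseteq> names (fill C e)"
  by (auto simp: names_def bound_fill_simple free_fill fst_defs)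

lemma vdom_append [simp]: "vdom (\<M> @ \<M>') = vdom \<M> @ vdom \<M>'"
  by (simp add: vdom_def)

text \<open>The new images are stacked along all of \<open>rvars \<Gamma>\<close>, the longest
  prefix, and their names lie outside \<open>N\<close>, hence outside the program and
  \<open>\<Delta>\<close>. The old entries stay correct because \<open>C\<close> defines no variable
  of \<open>\<Gamma>\<close>.\<close>

lemma coherent_fill:
  assumes coh: "coherent M N \<M> \<Gamma> \<Delta> (fill C e)" and C: "simple C"
    and ls: "distinct ls" "set ls \<subseteq> defs C" "{(x, \<tau>) \<in> defs C. x \<in> free e} \<subseteq> set ls"
    and ls': "length ls' = length ls" "distinct ls'" "set ls' \<inter> N = {}"
    and bs: "bs = map2 (\<lambda>x' (x, ns). (x', dtensor (rvars \<Gamma>) ns)) ls' ls"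
    and N': "N \<union> set ls' \<subseteq> N'"
  shows "coherent M N' (\<M> @ zip ls bs) (\<Gamma> @ ctx_bindings C) (\<Delta> @ bs) e"
proof -
  interpret coherent M N \<M> \<Gamma> \<Delta> "fill C e" by (rule coh)
  have bnd: "bound (fill C e) = map fst C @ bound e" by (rule bound_fill_simple[OF C])
  have entry: "((x, ms), (y, \<mu>)) \<in> set (zip ls bs) \<longleftrightarrow>
      (\<exists>i<length ls. ls ! i = (x, ms) \<and> ls' ! i = y \<and> \<mu> = dtensor (rvars \<Gamma>) ms)" for x ms y \<mu>
    unfolding bs by (rule map2_entry[OF ls'(1)])
  have keys: "map fst bs = ls'" unfolding bs by (rule map2_keys[OF ls'(1)])
  then have keys': "fst ` set bs = set ls'" by (metis set_map)
  have len: "length bs = length ls" by (simp add: bs ls')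
  have vd: "vdom (zip ls bs) = map fst ls"
    using len by (auto simp: vdom_def intro!: nth_equalityI split: prod.splits)
  \<comment> \<open>\<open>ls\<close> lists pairs without repetition; their names do not repeat
    either, because each name is bound once in \<open>C\<close>.\<close>
  have "inj_on fst (set ls)"
  proof (rule inj_onI)
    fix u w assume "u \<in> set ls" "w \<in> set ls" "fst u = fst w"
    then have "(fst u, snd u) \<in> defs C" "(fst u, snd w) \<in> defs C"
      using ls(2) by (metis prod.collapse subsetD)+
    then have "snd u = snd w"
      using distinct_bound by (intro defs_unique[of C]) (auto simp: bnd)
    with \<open>fst u = fst w\<close> show "u = w" by (rule prod_eqI)
  qed
  then have dist_ls: "distinct (map fst ls)" by (simp add: distinct_map ls(1))
  have ls_bound: "fst ` set ls \<subseteq> set (map fst C)"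
    using ls(2) by (metis fst_defs image_mono)
  have names_e: "names e \<subseteq> names (fill C e)" by (rule names_fill[OF C])
  show ?thesis
  proof
    show "distinct (vdom (\<M> @ zip ls bs))"
      using dist_ls ls_bound distinct_vdom vdom_tvars bound_tvars by (auto simp: vd bnd)
    show "set (vdom (\<M> @ zip ls bs)) \<subseteq> set (tvars (\<Gamma> @ ctx_bindings C))"
      using vdom_tvars ls_bound by (auto simp: vd fst_defs)
    fix x ms assume x: "x \<in> free e" "TVar x ms \<in> set (\<Gamma> @ ctx_bindings C)"
    show "\<exists>y bs'. ((x, ms), (y, dtensor bs' ms)) \<in> set (\<M> @ zip ls bs) \<and>
        take (length bs') (rvars (\<Gamma> @ ctx_bindings C)) = bs'"
    proof (cases "x \<in> fst ` defs C")
      case True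
      then have "x \<notin> set (tvars \<Gamma>)" using bound_tvars by (auto simp: bnd fst_defs)
      then have "(x, ms) \<in> defs C" using x by (auto simp: TVar_in_ctx_bindings in_set_tvars)
      then have "(x, ms) \<in> set ls" using ls(3) x by auto
      then obtain i where "i < length ls" "ls ! i = (x, ms)" by (metis in_set_conv_nth)
      then have "((x, ms), (ls' ! i, dtensor (rvars \<Gamma>) ms)) \<in> set (\<M> @ zip ls bs)"
        using entry by auto
      then show ?thesis by fastforce
    next
      case False
      then have "TVar x ms \<in> set \<Gamma>" using x by (force simp: TVar_in_ctx_bindings)
      moreover have "x \<in> free (fill C e)" using x False by (simp add: free_fill)
      ultimately show ?thesis using covered by fastforce
    qed
  next
    fix x ms y \<mu> assume xy: "((x, ms), (y, \<mu>)) \<in> set (\<M> @ zip ls bs)"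
    show "y = x \<or> y \<notin> names e"
    proof (cases "((x, ms), (y, \<mu>)) \<in> set \<M>")
      case True
      then show ?thesis using image_names names_e by blast
    next
      case False
      then have "y \<in> set ls'" using xy entry ls'(1) by fastforce
      then show ?thesis using ls'(3) names_N names_e by auto
    qed
    show "(y, \<mu>) \<in> set (\<Delta> @ bs)"
      using xy image_\<Delta> by (auto dest: set_zip_rightD)
    show "set (stacked \<mu>) \<subseteq> set (rvars (\<Gamma> @ ctx_bindings C))"
      using xy image_stacked entry by fastforce
  next
    show "distinct (map fst (\<Delta> @ bs))"
      using distinct_\<Delta> \<Delta>_N ls' by (auto simp: keys keys')
    show "fst ` set (\<Delta> @ bs) \<subseteq> N'" using \<Delta>_N N' by (auto simp: image_Un keys')
    show "fst ` set (\<Delta> @ bs) \<inter> set (bound e) = {}"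
      using \<Delta>_bound ls'(3) names_N by (auto simp: image_Un keys' bnd names_def)
    show "distinct (bound e)" "set (bound e) \<inter> set (tvars (\<Gamma> @ ctx_bindings C)) = {}"
      using distinct_bound bound_tvars by (auto simp: bnd fst_defs)
    show "names e \<subseteq> N'" using names_e names_N N' by auto
  qed (use distinct_rvars rvars_dom in auto)
qed

lemma map_upds_nth:
  "distinct xs \<Longrightarrow> length xs = length vs \<Longrightarrow> i < length xs \<Longrightarrow> (m(xs [\<mapsto>] vs)) (xs ! i) = Some (vs ! i)"
proof (induction xs arbitrary: vs i m)
  case (Cons x xs)
  then show ?case by (cases vs; cases i) auto
qed simp

text \<open>\<open>vs\<close> stands for the values of the emitted \<open>execute\<close>. Old
  entries survive, since \<open>C\<close> redefines none of their variables and \<open>ls'\<close>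
  overwrites none of their images.\<close>

lemma env_rel_fill:
  assumes coh: "coherent M N \<M> \<Gamma> \<Delta> (fill C e)" and C: "simple C"
    and ls': "length ls' = length ls" "distinct ls'" "set ls' \<inter> N = {}"
    and bs: "bs = map2 (\<lambda>x' (x, ns). (x', dtensor (rvars \<Gamma>) ns)) ls' ls"
    and rel: "env_rel \<M> \<gamma> \<gamma>'"
    and vs: "map (\<lambda>f. f (map (\<lambda>a. the (snd \<gamma> a)) (rvars \<Gamma>))) vs
      = map (\<lambda>x. the (fst (ctx_env M F C \<gamma>) x)) (map fst ls)"
  shows "env_rel (\<M> @ zip ls bs) (ctx_env M F C \<gamma>) (\<gamma>'(ls' [\<mapsto>] vs))"
proof -
  interpret coherent M N \<M> \<Gamma> \<Delta> "fill C e" by (rule coh)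
  have len: "length vs = length ls" using vs by (metis length_map)
  have "the (fst (ctx_env M F C \<gamma>) x)
      = the ((\<gamma>'(ls' [\<mapsto>] vs)) y) (map (\<lambda>b. the (snd \<gamma> b)) (stacked \<mu>))"
    if xy: "((x, ms), (y, \<mu>)) \<in> set (\<M> @ zip ls bs)" for x ms y \<mu>
  proof (cases "((x, ms), (y, \<mu>)) \<in> set \<M>")
    case True
    have "x \<notin> fst ` defs C"
      using in_vdom[OF True] vdom_tvars bound_tvars by (auto simp: fst_defs bound_fill_simple[OF C])
    moreover have "y \<notin> set ls'" using image_\<Delta>[OF True] \<Delta>_N ls'(3) by force
    ultimately show ?thesis
      using True rel by (force simp: env_rel_def fst_ctx_env_notin)
  next
    case False
    then obtain i where i: "i < length ls" "ls ! i = (x, ms)" "ls' ! i = y" "\<mu> = dtensor (rvars \<Gamma>) ms"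
      using xy map2_entry[OF ls'(1), of x ms y \<mu> "rvars \<Gamma>"] by (auto simp: bs)
    then have "(\<gamma>'(ls' [\<mapsto>] vs)) y = Some (vs ! i)"
      using ls' len map_upds_nth[of ls' vs i] by simp
    moreover have "(vs ! i) (map (\<lambda>a. the (snd \<gamma> a)) (rvars \<Gamma>)) = the (fst (ctx_env M F C \<gamma>) x)"
      using arg_cong[OF vs, of "\<lambda>l. l ! i"] i len by simp
    ultimately show ?thesis using i by simp
  qed
  then show ?thesis by (auto simp: env_rel_def)
qed

section \<open>Coherence and relatedness inside and after a loop\<close>

lemma coherent_body:
  assumes coh: "coherent M N \<M> \<Gamma> \<Delta> (Let x ns (Loop a \<sigma> e1) e2)"
    and a: "RVar a \<notin> set \<Gamma>" "a \<in> dom M"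
  shows "coherent M N \<M> (\<Gamma> @ [RVar a]) \<Delta> e1"
proof -
  interpret coherent M N \<M> \<Gamma> \<Delta> "Let x ns (Loop a \<sigma> e1) e2" by (rule coh)
  show ?thesis
  proof
    fix x ms assume "x \<in> free e1" "TVar x ms \<in> set (\<Gamma> @ [RVar a])"
    then obtain y bs where y: "((x, ms), (y, dtensor bs ms)) \<in> set \<M>"
      and bs: "take (length bs) (rvars \<Gamma>) = bs"
      using covered[of x ms] by auto
    \<comment> \<open>The equation forces \<open>bs\<close> to be no longer than
      \<open>rvars \<Gamma>\<close>; therefore appending \<open>a\<close> does not change what
      \<open>take\<close> returns.\<close>
    from bs have "length bs \<le> length (rvars \<Gamma>)" by (metis length_take min.cobounded1)
    then have "take (length bs) (rvars (\<Gamma> @ [RVar a])) = bs" using bs by simp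
    with y show "\<exists>y bs. ((x, ms), (y, dtensor bs ms)) \<in> set \<M> \<and>
        take (length bs) (rvars (\<Gamma> @ [RVar a])) = bs" by blast
  next
    fix x ms y \<mu> assume xy: "((x, ms), (y, \<mu>)) \<in> set \<M>"
    show "y = x \<or> y \<notin> names e1" using image_names[OF xy] by (auto simp: names_def)
    show "set (stacked \<mu>) \<subseteq> set (rvars (\<Gamma> @ [RVar a]))" using image_stacked[OF xy] by auto
  qed (use distinct_rvars rvars_dom distinct_bound bound_tvars names_N distinct_vdom vdom_tvars
      distinct_\<Delta> \<Delta>_N \<Delta>_bound image_\<Delta> a in \<open>auto simp: in_set_rvars names_def\<close>)
qed

text \<open>\<open>\<Delta>'\<close> holds everything emitted for the bound value, auxiliary
  bindings included; of these, only \<open>z\<close> becomes an image.\<close>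

lemma coherent_Let:
  assumes coh: "coherent M N \<M> \<Gamma> \<Delta> (Let x ns v e)"
    and \<Delta>': "distinct (map fst (\<Delta> @ \<Delta>'))" "fst ` set \<Delta>' \<inter> names e = {}"
      "N \<union> fst ` set \<Delta>' \<subseteq> N'" "(z, dtensor (rvars \<Gamma>) ns) \<in> set \<Delta>'"
  shows "coherent M N' (\<M> @ [((x, ns), (z, dtensor (rvars \<Gamma>) ns))]) (\<Gamma> @ [TVar x ns]) (\<Delta> @ \<Delta>') e"
proof -
  interpret coherent M N \<M> \<Gamma> \<Delta> "Let x ns v e" by (rule coh)
  have x: "x \<notin> set (tvars \<Gamma>)" using bound_tvars by auto
  have names_e: "names e \<subseteq> names (Let x ns v e)" by (auto simp: names_def)
  show ?thesis
  proof
    fix y ms assume y: "y \<in> free e" "TVar y ms \<in> set (\<Gamma> @ [TVar x ns])"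
    show "\<exists>z' bs. ((y, ms), (z', dtensor bs ms)) \<in> set (\<M> @ [((x, ns), (z, dtensor (rvars \<Gamma>) ns))]) \<and>
        take (length bs) (rvars (\<Gamma> @ [TVar x ns])) = bs"
    proof (cases "y = x")
      case True
      then have "ms = ns" using y x by (auto simp: in_set_tvars)
      with True show ?thesis by (intro exI[of _ z] exI[of _ "rvars \<Gamma>"]) simp
    next
      case False
      then show ?thesis using y covered[of y ms] by fastforce
    qed
  next
    fix y ms u \<mu> assume "((y, ms), (u, \<mu>)) \<in> set (\<M> @ [((x, ns), (z, dtensor (rvars \<Gamma>) ns))])"
    then consider "((y, ms), (u, \<mu>)) \<in> set \<M>" | "y = x" "u = z" "\<mu> = dtensor (rvars \<Gamma>) ns"
      by auto
    then have "(u = y \<or> u \<notin> names e) \<and> (u, \<mu>) \<in> set (\<Delta> @ \<Delta>') \<and> set (stacked \<mu>) \<subseteq> set (rvars \<Gamma>)"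
    proof cases
      case 1
      then show ?thesis using image_names[OF 1] image_\<Delta>[OF 1] image_stacked[OF 1] names_e by auto
    next
      case 2
      then show ?thesis using \<Delta>' by force
    qed
    then show "u = y \<or> u \<notin> names e" "(u, \<mu>) \<in> set (\<Delta> @ \<Delta>')"
      "set (stacked \<mu>) \<subseteq> set (rvars (\<Gamma> @ [TVar x ns]))" by simp_all
  next
    show "distinct (vdom (\<M> @ [((x, ns), (z, dtensor (rvars \<Gamma>) ns))]))"
      using distinct_vdom vdom_tvars x by (auto simp: vdom_def)
    show "set (vdom (\<M> @ [((x, ns), (z, dtensor (rvars \<Gamma>) ns))])) \<subseteq> set (tvars (\<Gamma> @ [TVar x ns]))"
      using vdom_tvars by (auto simp: vdom_def)
    show "fst ` set (\<Delta> @ \<Delta>') \<inter> set (bound e) = {}"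
      using \<Delta>_bound \<Delta>'(2) by (auto simp: names_def image_Un)
    show "fst ` set (\<Delta> @ \<Delta>') \<subseteq> N'"
      using \<Delta>_N \<Delta>'(3) by (auto simp: image_Un)
    show "distinct (map fst (\<Delta> @ \<Delta>'))" by (rule \<Delta>'(1))
    show "names e \<subseteq> N'" using names_e names_N \<Delta>'(3) by auto
  qed (use distinct_rvars rvars_dom distinct_bound bound_tvars in auto)
qed

text \<open>An image that is not stacked along \<open>a\<close> is read at the same indices whatever
  the iteration.\<close>

lemma env_rel_fun_upd:
  assumes "env_rel \<M> \<gamma> \<gamma>'" "\<And>x ms y \<mu>. ((x, ms), (y, \<mu>)) \<in> set \<M> \<Longrightarrow> a \<notin> set (stacked \<mu>)"
  shows "env_rel \<M> (fst \<gamma>, (snd \<gamma>)(a \<mapsto> j)) \<gamma>'"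
proof -
  have "the (fst \<gamma> x) = the (\<gamma>' y) (map (\<lambda>b. the (((snd \<gamma>)(a \<mapsto> j)) b)) (stacked \<mu>))"
    if xy: "((x, ms), (y, \<mu>)) \<in> set \<M>" for x ms y \<mu>
  proof -
    have *: "map (\<lambda>b. the (((snd \<gamma>)(a \<mapsto> j)) b)) (stacked \<mu>) = map (\<lambda>b. the (snd \<gamma> b)) (stacked \<mu>)"
      using assms(2)[OF xy] by auto
    show ?thesis unfolding * by (rule env_relD[OF assms(1) xy])
  qed
  then show ?thesis by (auto simp: env_rel_def)
qed

lemma env_rel_Let:
  assumes rel: "env_rel \<M> \<gamma> \<gamma>'" and x: "x \<notin> set (vdom \<M>)"
    and old: "\<And>x ms y \<mu>. ((x, ms), (y, \<mu>)) \<in> set \<M> \<Longrightarrow> \<gamma>'' y = \<gamma>' y"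
    and new: "the (\<gamma>'' z) (map (\<lambda>b. the (snd \<gamma> b)) as) = A"
  shows "env_rel (\<M> @ [((x, ns), (z, dtensor as ns))]) ((fst \<gamma>)(x \<mapsto> A), snd \<gamma>) \<gamma>''"
proof -
  have "the (((fst \<gamma>)(x \<mapsto> A)) y) = the (\<gamma>'' u) (map (\<lambda>b. the (snd \<gamma> b)) (stacked \<mu>))"
    if yu: "((y, ms), (u, \<mu>)) \<in> set \<M>" for y ms u \<mu>
  proof -
    have "y \<noteq> x" using in_vdom[OF yu] x by blast
    then show ?thesis using yu rel old[OF yu] by (force simp: env_rel_def)
  qed
  then show ?thesis using new by (auto simp: env_rel_def)
qed

text \<open>This evaluates the search for the distributed dimension in the meaning of
  \<open>redistribute\<close>.\<close>

lemma filter_eq_upt: "d < n \<Longrightarrow> filter (\<lambda>k. k = d) [0..<n] = [d]"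
proof (induction n)
  case (Suc n)
  have "filter (\<lambda>k. k = n) [0..<n] = []" by (auto simp: filter_empty_conv)
  with Suc show ?case by (cases "d = n") auto
qed simp

section \<open>Correctness\<close>

text \<open>The two typing rules for loops in one formula, with \<open>ns1\<close> the shape of the
  body and \<open>ns\<close> that of the loop; it also records that the action names the axis of the
  loop.\<close>

definition loop_shape :: "'a mesh \<Rightarrow> 'a \<Rightarrow> 'a action \<Rightarrow> shape \<Rightarrow> shape \<Rightarrow> bool" where
  "loop_shape M a \<sigma> ns1 ns = (case \<sigma> of
     Sum b \<Rightarrow> b = a \<and> ns = ns1
   | Tile b d \<Rightarrow> b = a \<and> d < length ns1 \<and> ns = ns1[d := ns1 ! d * the (M a)])"

lemma ctyp_val_Loop:
  assumes "ctyp_val M T \<Gamma> (Loop a \<sigma> e) ns"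
  obtains ns1 where "ctyp M T (\<Gamma> @ [RVar a]) e [ns1]" "RVar a \<notin> set \<Gamma>" "a \<in> dom M"
    "loop_shape M a \<sigma> ns1 ns"
  using assms by (cases rule: ctyp_LoopE) (auto simp: loop_shape_def intro: that)

text \<open>\<open>z\<close> holds the results of all iterations, its last stacked axis being that
  of the loop. For a sum, \<open>tile_reduce\<close> adds them up. For a tile, it only rereads the
  last stacked index as a distribution index, and \<open>redistribute\<close> performs the
  concatenation.\<close>

lemma reduce_loop:
  assumes mesh: "wf_mesh M" and ops: "wf_ops T F"
    and e: "ctyp M T (\<Gamma> @ [RVar a]) e [ns1]" and a: "a \<in> dom M"
    and shape: "loop_shape M a \<sigma> ns1 ns"
    and \<Delta>: "(z, dtensor (rvars \<Gamma> @ [a]) ns1) \<in> set \<Delta>" "distinct (map fst \<Delta>)" "fst ` set \<Delta> \<subseteq> N"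
    and z': "z' \<notin> N"
    and Cs: "case \<sigma> of
        Sum b \<Rightarrow> Cs = [([(z', dtensor (rvars \<Gamma>) ns)], TileReduce (Sum b) z)]
      | Tile b d \<Rightarrow> \<exists>z0. z0 \<notin> N \<and> z0 \<noteq> z' \<and>
          Cs = [([(z0, DTensor (rvars \<Gamma>) ((map (Pair []) ns)[d := ([b], ns ! d)]))], TileReduce (Tile b d) z),
                ([(z', dtensor (rvars \<Gamma>) ns)], Redistribute z0 (dtensor (rvars \<Gamma>) ns))]"
  shows reduce_loop_bindings: "distinct (map fst (\<Delta> @ sctx_bindings Cs))"
      "fst ` set (sctx_bindings Cs) \<inter> N = {}"
      "(z', dtensor (rvars \<Gamma>) ns) \<in> set (sctx_bindings Cs)"
    and reduce_loop_styp: "styp M T (\<Delta> @ sctx_bindings Cs) e' \<mu>s \<Longrightarrow> styp M T \<Delta> (sfill Cs e') \<mu>s"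
    and reduce_loop_sem: "\<lbrakk>valid_env M \<Gamma> \<gamma>;
      \<And>j. j < the (M a) \<Longrightarrow> the (\<gamma>' z) (map (\<lambda>b. the (snd \<gamma> b)) (rvars \<Gamma>) @ [j])
        = hd (csem M F e (fst \<gamma>, (snd \<gamma>)(a \<mapsto> j)))\<rbrakk>
      \<Longrightarrow> the (sctx_env M F \<Delta> Cs \<gamma>' z') (map (\<lambda>b. the (snd \<gamma> b)) (rvars \<Gamma>))
        = csem_val M F (Loop a \<sigma> e) \<gamma>"
proof -
  obtain n where n: "M a = Some n" using a by auto
  have pos: "0 < n" using wf_mesh_pos[OF mesh n] .
  have z_type: "type_of \<Delta> z = dtensor (rvars \<Gamma> @ [a]) ns1" by (rule type_of_eq[OF \<Delta>(2,1)])
  define is0 where "is0 = map (\<lambda>b. the (snd \<gamma> b)) (rvars \<Gamma>)"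
  have indices: "is0 \<in> indices (sizes M (rvars \<Gamma>))"
    "j < n \<Longrightarrow> is0 @ [j] \<in> indices (sizes M (rvars \<Gamma> @ [a]))" if "valid_env M \<Gamma> \<gamma>" for j
    using valid_env_indices[OF that] n by (auto simp: is0_def indices_def sizes_def nth_append less_Suc_eq)
  \<comment> \<open>One conjunction, so that sum and tile are distinguished only once.\<close>
  have "distinct (map fst (\<Delta> @ sctx_bindings Cs)) \<and> fst ` set (sctx_bindings Cs) \<inter> N = {} \<and>
      (z', dtensor (rvars \<Gamma>) ns) \<in> set (sctx_bindings Cs) \<and>
      (styp M T (\<Delta> @ sctx_bindings Cs) e' \<mu>s \<longrightarrow> styp M T \<Delta> (sfill Cs e') \<mu>s) \<and>
      (valid_env M \<Gamma> \<gamma> \<and> (\<forall>j<n. the (\<gamma>' z) (is0 @ [j]) = hd (csem M F e (fst \<gamma>, (snd \<gamma>)(a \<mapsto> j))))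
        \<longrightarrow> the (sctx_env M F \<Delta> Cs \<gamma>' z') is0 = csem_val M F (Loop a \<sigma> e) \<gamma>)"
  proof (cases \<sigma>)
    case (Sum b)
    then have [simp]: "b = a" "ns1 = ns" using shape by (auto simp: loop_shape_def)
    have Cs': "Cs = [([(z', dtensor (rvars \<Gamma>) ns)], TileReduce (Sum a) z)]" using Cs Sum by simp
    have "styp_val M T \<Delta> (TileReduce (Sum a) z) [dtensor (rvars \<Gamma>) ns]"
      using styp_Sum[of z "rvars \<Gamma>" a "map (Pair []) ns"] \<Delta>(1) by (simp add: dtensor_def)
    moreover have "tsum n (\<lambda>j. the (\<gamma>' z) (is0 @ [j]))
        = tsum n (\<lambda>j. hd (csem M F e (fst \<gamma>, (snd \<gamma>)(a \<mapsto> j))))"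
      if "\<forall>j<n. the (\<gamma>' z) (is0 @ [j]) = hd (csem M F e (fst \<gamma>, (snd \<gamma>)(a \<mapsto> j)))"
      using that pos by (intro tsum_cong) auto
    ultimately show ?thesis
      using \<Delta>(2,3) z' indices(1)
      by (auto simp: Cs' Sum z_type n intro!: styp_Let)
  next
    case (Tile b d)
    then have [simp]: "b = a" and d: "d < length ns1" and ns: "ns = ns1[d := ns1 ! d * n]"
      using shape by (auto simp: loop_shape_def n)
    define \<rho>s where "\<rho>s = (map (Pair []) ns)[d := ([a], ns ! d)]"
    obtain z0 where z0: "z0 \<notin> N" "z0 \<noteq> z'"
      and Cs': "Cs = [([(z0, DTensor (rvars \<Gamma>) \<rho>s)], TileReduce (Tile a d) z),
                ([(z', dtensor (rvars \<Gamma>) ns)], Redistribute z0 (dtensor (rvars \<Gamma>) ns))]"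
      using Cs Tile by (auto simp: \<rho>s_def)
    \<comment> \<open>The empty list is written out to match the typing rule of
      \<open>tile_reduce\<close>, which appends \<open>a\<close> to the axes already present in the
      dimension.\<close>
    have \<rho>s: "\<rho>s = (map (Pair []) ns1)[d := ([] @ [a], ns1 ! d * n)]"
      using d by (simp add: \<rho>s_def ns map_update)
    have tile: "styp_val M T \<Delta> (TileReduce (Tile a d) z) [DTensor (rvars \<Gamma>) \<rho>s]"
      unfolding \<rho>s using \<Delta>(1) d n by (intro styp_Tile) (auto simp: dtensor_def)
    \<comment> \<open>\<open>redistribute\<close> is given a meaning only if the target has the
      global shape of the operand.\<close>
    have global: "global_shape (DTensor (rvars \<Gamma>) \<rho>s) = ns"
      by (simp add: global_shape_def \<rho>s_def map_update comp_def)
    have redist: "styp_val M T (\<Delta> @ [(z0, DTensor (rvars \<Gamma>) \<rho>s)])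
        (Redistribute z0 (dtensor (rvars \<Gamma>) ns)) [dtensor (rvars \<Gamma>) ns]"
      by (rule styp_Redistribute) (use global in auto)
    have z0_type: "type_of (\<Delta> @ [(z0, DTensor (rvars \<Gamma>) \<rho>s)]) z0 = DTensor (rvars \<Gamma>) \<rho>s"
      using \<Delta>(2,3) z0(1) by (intro type_of_eq) auto
    have "filter (\<lambda>k. fst (\<rho>s ! k) \<noteq> []) [0..<length \<rho>s] = filter (\<lambda>k. k = d) [0..<length \<rho>s]"
      using d by (intro filter_cong) (auto simp: \<rho>s nth_list_update)
    then have filter: "filter (\<lambda>k. fst (\<rho>s ! k) \<noteq> []) [0..<length \<rho>s] = [d]"
      using d by (simp add: filter_eq_upt \<rho>s)
    have \<rho>sd: "fst (\<rho>s ! d) = [a]" using d by (simp add: \<rho>s)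
    have sem: "the (sctx_env M F \<Delta> Cs \<gamma>' z') is0 = csem_val M F (Loop a \<sigma> e) \<gamma>"
      if valid: "valid_env M \<Gamma> \<gamma>"
        and body: "\<forall>j<n. the (\<gamma>' z) (is0 @ [j]) = hd (csem M F e (fst \<gamma>, (snd \<gamma>)(a \<mapsto> j)))"
    proof -
      have "list_all2 (\<lambda>A n. A \<in> tensors n) (csem M F e (fst \<gamma>, (snd \<gamma>)(a \<mapsto> 0))) [ns1]"
        using valid by (intro csem_in_tensors[OF e mesh ops]) (simp add: valid_env_def)
      \<comment> \<open>This shows \<open>d\<close> to be a dimension of the first block, as
        \<open>tconcat_cong\<close> requires.\<close>
      then have shape0: "shape_of (hd (csem M F e (fst \<gamma>, (snd \<gamma>)(a \<mapsto> 0)))) = ns1"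
        by (auto simp: list_all2_Cons2 tensors_def)
      have "the (sctx_env M F \<Delta> Cs \<gamma>' z') is0
          = tconcat d n (\<lambda>j. (\<lambda>is\<in>indices (sizes M (rvars \<Gamma> @ [a])). the (\<gamma>' z) is) (is0 @ [j]))"
        using indices(1)[OF valid] z0 by (simp add: Cs' z_type z0_type filter \<rho>sd global n Let_def)
      also have "\<dots> = tconcat d n (\<lambda>j. hd (csem M F e (fst \<gamma>, (snd \<gamma>)(a \<mapsto> j))))"
        using indices(2)[OF valid] body pos d shape0 by (intro tconcat_cong) auto
      finally show ?thesis by (simp add: Tile n)
    qed
    have "z0 \<notin> fst ` set \<Delta>" "z' \<notin> fst ` set \<Delta>" using \<Delta>(3) z0 z' by blast+
    then have "styp M T (\<Delta> @ sctx_bindings Cs) e' \<mu>s \<longrightarrow> styp M T \<Delta> (sfill Cs e') \<mu>s"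
      using z0(2) tile redist by (simp add: Cs') (intro impI styp_Let, simp_all)
    then show ?thesis
      using sem \<Delta>(2,3) z0 z' by (auto simp: Cs')
  qed
  then show "distinct (map fst (\<Delta> @ sctx_bindings Cs))"
      "fst ` set (sctx_bindings Cs) \<inter> N = {}"
      "(z', dtensor (rvars \<Gamma>) ns) \<in> set (sctx_bindings Cs)"
    and "styp M T (\<Delta> @ sctx_bindings Cs) e' \<mu>s \<Longrightarrow> styp M T \<Delta> (sfill Cs e') \<mu>s"
    and "\<lbrakk>valid_env M \<Gamma> \<gamma>;
      \<And>j. j < the (M a) \<Longrightarrow> the (\<gamma>' z) (map (\<lambda>b. the (snd \<gamma> b)) (rvars \<Gamma>) @ [j])
        = hd (csem M F e (fst \<gamma>, (snd \<gamma>)(a \<mapsto> j)))\<rbrakk>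
      \<Longrightarrow> the (sctx_env M F \<Delta> Cs \<gamma>' z') (map (\<lambda>b. the (snd \<gamma> b)) (rvars \<Gamma>))
        = csem_val M F (Loop a \<sigma> e) \<gamma>"
    by (simp_all add: n is0_def)
qed

text \<open>Inside a loop every binder on the \<open>let\<close> spine is newly introduced. At top
  level this can fail: the final yield keeps the binders of \<open>C\<close>, which are names of the
  Core program.\<close>

lemma trans_avoid_slet_bound:
  "trans_avoid N \<M> \<sigma>s C e e' \<Longrightarrow> \<sigma>s \<noteq> [] \<Longrightarrow> slet_bound e' \<inter> N = {}"
proof (induction rule: trans_avoid.induct)
  case (TLoop ls C e1 e2 as \<sigma>s zs ls' N bs Cs \<M> N1 \<M>1 \<sigma> Cs1 z N2 \<mu> ns z' Cs2 N3 x e' a)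
  have "fst ` set (sctx_bindings Cs) \<inter> N = {}"
  proof (cases "ls = []")
    case False
    then have "sctx_bindings Cs = bs" using TLoop.hyps by auto
    moreover have "map fst bs = ls'" unfolding TLoop.hyps by (rule map2_keys[OF TLoop.hyps(6)])
    ultimately show ?thesis using TLoop.hyps by (metis set_map)
  qed (use TLoop.hyps in simp)
  moreover have "fst ` set (sctx_bindings Cs1) \<inter> N1 = {}" using TLoop.IH(1) by auto
  moreover have "fst ` set (sctx_bindings Cs2) \<inter> N2 = {}"
    using TLoop.hyps by (auto split: action.splits)
  moreover have "slet_bound e' \<inter> N3 = {}" using TLoop.IH(2) TLoop.prems by simp
  ultimately show ?case using TLoop.hyps by auto
qed auto

text \<open>The two-stage renaming of the rule, first in the hole and then in \<open>C\<close>,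
  amounts to one application of \<open>vapp \<M>\<close> to the whole program, and to that the
  substitution lemmas apply.\<close>

lemma yield_top:
  fixes \<Gamma> :: "('v, 'a) cctx"
  assumes coh: "coherent M N \<M> \<Gamma> \<Delta> (fill C (Yield [x]))" and C: "simple C"
    and ty: "ctyp M T \<Gamma> (fill C (Yield [x])) [ns]" and top: "rvars \<Gamma> = []"
    and zs: "set zs = free_ctx C"
    and e': "core_as_spmd (subst (ren zs (map (vapp \<M>) zs)) (fill C (Yield [vapp \<M> x]))) e'"
  shows "styp M T \<Delta> e' [dtensor [] ns]"
    and "env_rel \<M> \<gamma> \<gamma>' \<Longrightarrow> hd (ssem M F \<Delta> e' \<gamma>') [] = hd (csem M F (fill C (Yield [x])) \<gamma>)"
proof -
  define p where "p = fill C (Yield [x])"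
  interpret coherent M N \<M> \<Gamma> \<Delta> p unfolding p_def by (rule coh)
  have bnd: "bound p = map fst C" by (simp add: p_def bound_fill_simple[OF C])
  have typed: "\<exists>ms. TVar z ms \<in> set \<Gamma>" if "z \<in> free p" for z
    using ctyp_free[OF ty] that by (auto simp: p_def in_set_tvars)
  \<comment> \<open>Without range variables the only prefix is the empty one, so the image of every
    free variable is an unstacked tensor.\<close>
  have image: "(vapp \<M> z, dtensor [] ms) \<in> set \<Delta> \<and> ((z, ms), (vapp \<M> z, dtensor [] ms)) \<in> set \<M>"
    if "z \<in> free p" "TVar z ms \<in> set \<Gamma>" for z ms
    using covered_vapp[OF that] top by (metis take_Nil)
  have "subst (ren zs (map (vapp \<M>) zs)) (fill C (Yield [vapp \<M> x])) = subst (vapp \<M>) p"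
    unfolding p_def
  proof (rule subst_fill_cong)
    show "ren zs (map (vapp \<M>) zs) z = vapp \<M> z" if "z \<in> free_ctx C" for z
      using that zs by (simp add: ren_map)
    show "subst (\<lambda>z. if z \<in> fst ` defs C then z else ren zs (map (vapp \<M>) zs) z) (Yield [vapp \<M> x])
        = subst (\<lambda>z. if z \<in> fst ` defs C then z else vapp \<M> z) (Yield [x])"
    proof (cases "x \<in> fst ` defs C")
      case True
      \<comment> \<open>A variable defined by \<open>C\<close> has no entry and is its own
        image.\<close>
      then have "x \<notin> set (vdom \<M>)"
        using bound_tvars vdom_tvars by (auto simp: bnd fst_defs)
      with True show ?thesis by (simp add: vapp_notin)
    next
      case False
      then have x: "x \<in> free p" by (simp add: p_def free_fill)
      then obtain ms where "TVar x ms \<in> set \<Gamma>" using typed by blast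
      note im = image[OF x this]
      then have "vapp \<M> x \<in> fst ` set \<Delta>" by force
      then have "vapp \<M> x \<notin> fst ` defs C" using \<Delta>_bound by (auto simp: bnd fst_defs)
      \<comment> \<open>Nothing is renamed twice: if the image of \<open>x\<close> is itself free in
        \<open>C\<close>, it is a name of the program, and then it can only be
        \<open>x\<close>.\<close>
      moreover have "ren zs (map (vapp \<M>) zs) (vapp \<M> x) = vapp \<M> x"
      proof (cases "vapp \<M> x \<in> set zs")
        case True
        then have "vapp \<M> x \<in> names p" by (simp add: names_def p_def free_fill zs)
        then have "vapp \<M> x = x" using image_names im by blast
        with True show ?thesis by (metis ren_map)
      qed (simp add: ren_notin)
      ultimately show ?thesis using False by simp
    qed
  qed
  then have e'p: "core_as_spmd (subst (vapp \<M>) p) e'" using e' by simp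
  have image_bound: "vapp \<M> ` free p \<inter> set (bound p) = {}"
    using typed image \<Delta>_bound by (force simp: image_iff)
  \<comment> \<open>The part of \<open>\<Delta>\<close> that a Core context can express.\<close>
  define \<Gamma>' :: "('v, 'a) cctx" where "\<Gamma>' = map (\<lambda>(y, \<mu>). TVar y (global_shape \<mu>))
    (filter (\<lambda>(y, \<mu>). \<mu> = dtensor [] (global_shape \<mu>)) \<Delta>)"
  have \<Gamma>': "TVar y ms \<in> set \<Gamma>' \<longleftrightarrow> (y, dtensor [] ms) \<in> set \<Delta>" for y ms
    by (force simp: \<Gamma>'_def)
  have "RVar b \<notin> set \<Gamma>'" for b by (auto simp: \<Gamma>'_def)
  then have "rvars \<Gamma>' = []" by (metis in_set_rvars list.set_intros(1) neq_Nil_conv)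
  moreover have "set (tvars \<Gamma>') \<inter> set (bound p) = {}"
    using \<Delta>_bound by (force simp: in_set_tvars \<Gamma>')
  ultimately have "ctyp M T \<Gamma>' (subst (vapp \<M>) p) [ns]"
    using image distinct_bound top ty by (intro ctyp_subst[of M T \<Gamma>]) (auto simp: \<Gamma>' p_def)
  from core_as_spmd_styp[OF e'p this \<Gamma>'] show "styp M T \<Delta> e' [dtensor [] ns]"
    using \<Delta>_bound distinct_bound by (simp add: Int_commute)
  assume rel: "env_rel \<M> \<gamma> \<gamma>'"
  have "map (\<lambda>f. f []) (ssem M F \<Delta> e' \<gamma>') = csem M F (subst (vapp \<M>) p) (\<lambda>x. Some (the (\<gamma>' x) []), snd \<gamma>)"
    by (rule core_as_spmd_sem[OF e'p])
  also have "\<dots> = csem M F p (fst \<gamma>, snd \<gamma>)"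
  proof (rule csem_subst)
    fix z assume z: "z \<in> free p"
    then obtain ms where "TVar z ms \<in> set \<Gamma>" using typed by blast
    with image[OF z] env_rel_entry[OF rel, of z ms "vapp \<M> z" "[]"]
    show "the (Some (the (\<gamma>' (vapp \<M> z)) [])) = the (fst \<gamma> z)" by simp
  qed (use image_bound distinct_bound in auto)
  finally have eq: "map (\<lambda>f. f []) (ssem M F \<Delta> e' \<gamma>') = csem M F p \<gamma>" by simp
  \<comment> \<open>\<open>hd\<close> commutes with \<open>map\<close> on nonempty lists
    only.\<close>
  moreover have "csem M F p \<gamma> \<noteq> []"
    using length_csem[of M F p \<gamma>] by (auto simp: p_def)
  ultimately show "hd (ssem M F \<Delta> e' \<gamma>') [] = hd (csem M F (fill C (Yield [x])) \<gamma>)"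
    by (metis (mono_tags, lifting) list.map_sel(1) map_is_Nil_conv p_def)
qed

text \<open>The yield rules pick some entry for \<open>x\<close>, while coherence provides one with
  the right shape and a prefix of axes; as a variable has at most one entry, the two are the same.
  So the prefix property is available where the rule only asks for inclusion of axes.\<close>

lemma (in coherent) entry_shape:
  assumes "((x, ms), (z, \<mu>)) \<in> set \<M>" "x \<in> free p" "TVar x ns \<in> set \<Gamma>"
  obtains bs where "z = vapp \<M> x" "ms = ns" "\<mu> = dtensor bs ns" "take (length bs) (rvars \<Gamma>) = bs"
proof -
  obtain bs where bs: "((x, ns), (vapp \<M> x, dtensor bs ns)) \<in> set \<M>" "take (length bs) (rvars \<Gamma>) = bs"
    using covered_vapp[OF assms(2,3)] by blast
  have "z = vapp \<M> x \<and> ms = ns \<and> \<mu> = dtensor bs ns"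
    using distinct_vdom assms(1) bs(1) unfolding vdom_def distinct_map inj_on_def by fastforce
  with bs that show ?thesis by blast
qed

lemma ctyp_Yield_single: "ctyp M T \<Gamma> (Yield [x]) [ns] \<longleftrightarrow> TVar x ns \<in> set \<Gamma>"
  by (auto elim!: ctyp_YieldE intro!: ctyp_Yield)

lemma styp_let_yield:
  assumes "styp_val M T \<Delta> v [\<mu>]" "x' \<notin> fst ` set \<Delta>"
  shows "styp M T \<Delta> (SLet [(x', \<mu>)] v (SYield [x'])) [\<mu>]"
  using assms by (intro styp_Let) (auto intro!: styp_Yield)

text \<open>The environments stay quantified inside the conclusion, because a loop body is evaluated
  at as many Core environments as its axis has values.\<close>

lemma trans_avoid_correct:
  assumes "trans_avoid N \<M> \<sigma>s C e e'" and mesh: "wf_mesh M" and ops: "wf_ops T F"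
    and "coherent M N \<M> \<Gamma> \<Delta> (fill C e)" "simple C" "ctyp M T \<Gamma> (fill C e) [ns]" "axes \<sigma>s = rvars \<Gamma>"
  shows "styp M T \<Delta> e' [dtensor (rvars \<Gamma>) ns] \<and>
    (\<forall>\<gamma> \<gamma>'. valid_env M \<Gamma> \<gamma> \<longrightarrow> env_rel \<M> \<gamma> \<gamma>' \<longrightarrow>
      hd (ssem M F \<Delta> e' \<gamma>') (map (\<lambda>a. the (snd \<gamma> a)) (rvars \<Gamma>)) = hd (csem M F (fill C e) \<gamma>))"
  using assms(1,4-)
proof (induction arbitrary: \<Gamma> \<Delta> ns rule: trans_avoid.induct)
  case (TOp N \<M> \<sigma>s C x \<tau> f ys e e')
  then show ?case using TOp.IH[of \<Gamma> \<Delta> ns] by simp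
next
  case (TSlice N \<M> \<sigma>s C x \<tau> d y a e e')
  then show ?case using TSlice.IH[of \<Gamma> \<Delta> ns] by simp
next
  case (TYldTop zs C y \<M> x e' N)
  have top: "rvars \<Gamma> = []" using TYldTop.prems by (simp add: axes_def)
  note * = yield_top[OF TYldTop.prems(1-3) top TYldTop.hyps(2) TYldTop.hyps(4)[unfolded TYldTop.hyps(3)]]
  show ?case unfolding top using *(1) *(2)[where F = F] by simp
next
  case (TYldL x ns' C as \<sigma>s \<sigma> zs ys x' N v \<M>)
  interpret coherent M N \<M> \<Gamma> \<Delta> "fill C (Yield [x])" by (rule TYldL.prems)
  have as: "as = rvars \<Gamma>" using TYldL by simp
  have "distinct (map fst C)" "set (map fst C) \<inter> set (tvars \<Gamma>) = {}"
    using distinct_bound bound_tvars by (auto simp: bound_fill_simple TYldL.prems)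
  moreover have x: "x \<in> fst ` defs C" using TYldL.hyps(1) by force
  ultimately have "x \<notin> set (tvars \<Gamma>)" by (auto simp: fst_defs)
  then have "(x, ns) \<in> defs C"
    using ctyp_fillD[OF TYldL.prems(3)]
    by (auto simp: ctyp_Yield_single TVar_in_ctx_bindings in_set_tvars)
  \<comment> \<open>The annotation chosen by the rule and the type of the program both come from
    \<open>defs C\<close>, where a name has one shape.\<close>
  then have "ns' = ns"
    by (rule defs_unique[OF \<open>distinct (map fst C)\<close> TYldL.hyps(1)])
  have "set [x] \<subseteq> fst ` defs C" using x by simp
  note exe = execute_context[OF refl TYldL.prems(2,3) this TYldL.hyps(3,4,5) _ _
      TYldL.hyps(8)[unfolded as]]
  have styp: "styp_val M T \<Delta> v [dtensor (rvars \<Gamma>) ns]"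
    using exe(1) TYldL.hyps(6,7) by simp
  have x': "x' \<notin> fst ` set \<Delta>" using TYldL.hyps(7) \<Delta>_N by auto
  have sem: "map (\<lambda>f. f (map (\<lambda>a. the (snd \<gamma> a)) (rvars \<Gamma>))) (ssem_val M F \<Delta> v \<gamma>')
      = csem M F (fill C (Yield [x])) \<gamma>" if "valid_env M \<Gamma> \<gamma>" "env_rel \<M> \<gamma> \<gamma>'" for \<gamma> \<gamma>'
    using exe(2) that TYldL.hyps(6,7) by simp
  have "hd (ssem M F \<Delta> (SLet [(x', dtensor as ns')] v (SYield [x'])) \<gamma>') (map (\<lambda>a. the (snd \<gamma> a)) (rvars \<Gamma>))
      = hd (csem M F (fill C (Yield [x])) \<gamma>)" if "valid_env M \<Gamma> \<gamma>" "env_rel \<M> \<gamma> \<gamma>'" for \<gamma> \<gamma>'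
  proof -
    \<comment> \<open>The tuple has one component, so comparing heads loses nothing.\<close>
    have "length (csem M F (fill C (Yield [x])) \<gamma>) = 1" by (simp add: length_csem)
    with sem[OF that] obtain g where "ssem_val M F \<Delta> v \<gamma>' = [g]"
      by (metis One_nat_def length_0_conv length_Suc_conv length_map)
    with sem[OF that] show ?thesis by (auto simp flip: sem[OF that])
  qed
  with styp_let_yield[OF styp x'] show ?case by (simp add: as \<open>ns' = ns\<close>)
next
  case (TYldP x C as \<sigma>s \<sigma> ns' z cs \<M> x' y N v)
  interpret coherent M N \<M> \<Gamma> \<Delta> "fill C (Yield [x])" by (rule TYldP.prems)
  have as: "as = rvars \<Gamma>" using TYldP by simp
  have "TVar x ns \<in> set \<Gamma>"
    using ctyp_fillD[OF TYldP.prems(3)] TYldP.hyps(1)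
    by (force simp: ctyp_Yield_single TVar_in_ctx_bindings)
  moreover have "x \<in> free (fill C (Yield [x]))" using TYldP.hyps(1) by (simp add: free_fill)
  ultimately have ns: "ns' = ns" and cs: "take (length cs) (rvars \<Gamma>) = cs"
    using entry_shape[OF TYldP.hyps(3)] by auto
  have z: "(z, dtensor cs ns) \<in> set \<Delta>" using image_\<Delta>[OF TYldP.hyps(3)] by (simp add: ns)
  then have z_type: "type_of \<Delta> z = dtensor cs ns" by (rule type_of_eq[OF distinct_\<Delta>])
  \<comment> \<open>The operand is replicated along the range variables missing from
    \<open>cs\<close>.\<close>
  have "styp_val M T \<Delta> (Execute (rvars \<Gamma>) [z] [y] (Yield [y])) (map (dtensor (rvars \<Gamma>)) [ns])"
    by (rule styp_Execute[where \<mu>s = "[dtensor cs ns]", OF _ _ refl])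
      (use z distinct_rvars rvars_dom in \<open>auto simp: wf_cctx_def ctyp_Yield_single\<close>)
  then have "styp_val M T \<Delta> v [dtensor (rvars \<Gamma>) ns]" by (simp only: TYldP.hyps(8) as list.map)
  moreover have "x' \<notin> fst ` set \<Delta>" using TYldP.hyps(6) \<Delta>_N by auto
  ultimately have styp: "styp M T \<Delta> (SLet [(x', dtensor as ns')] v (SYield [x'])) [dtensor (rvars \<Gamma>) ns]"
    using styp_let_yield by (simp add: as ns)
  have "hd (ssem M F \<Delta> (SLet [(x', dtensor as ns')] v (SYield [x'])) \<gamma>') (map (\<lambda>a. the (snd \<gamma> a)) (rvars \<Gamma>))
      = hd (csem M F (fill C (Yield [x])) \<gamma>)" if "valid_env M \<Gamma> \<gamma>" "env_rel \<M> \<gamma> \<gamma>'" for \<gamma> \<gamma>'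
    using valid_env_indices[OF that(1)] env_rel_entry[OF that(2) TYldP.hyps(3)] cs TYldP.hyps(1)
    by (simp add: TYldP.hyps(8) as z_type take_map csem_fill fst_ctx_env_notin)
  with styp show ?case by blast
next
  case (TYldC x C as \<sigma>s \<sigma> ns' z \<M> N)
  interpret coherent M N \<M> \<Gamma> \<Delta> "fill C (Yield [x])" by (rule TYldC.prems)
  have as: "as = rvars \<Gamma>" using TYldC by simp
  have "TVar x ns \<in> set \<Gamma>"
    using ctyp_fillD[OF TYldC.prems(3)] TYldC.hyps(1)
    by (force simp: ctyp_Yield_single TVar_in_ctx_bindings)
  moreover have "x \<in> free (fill C (Yield [x]))" using TYldC.hyps(1) by (simp add: free_fill)
  ultimately have ns: "ns' = ns" using entry_shape[OF TYldC.hyps(3)] by auto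
  have "styp M T \<Delta> (SYield [z]) [dtensor (rvars \<Gamma>) ns]"
    using image_\<Delta>[OF TYldC.hyps(3)] by (intro styp_Yield) (simp add: as ns)
  moreover have "hd (ssem M F \<Delta> (SYield [z]) \<gamma>') (map (\<lambda>a. the (snd \<gamma> a)) (rvars \<Gamma>))
      = hd (csem M F (fill C (Yield [x])) \<gamma>)" if "env_rel \<M> \<gamma> \<gamma>'" for \<gamma> \<gamma>'
    using env_rel_entry[OF that TYldC.hyps(3)] TYldC.hyps(1)
    by (simp add: as csem_fill fst_ctx_env_notin)
  ultimately show ?case by blast
next
  case (TLoop ls C e1 e2 as \<sigma>s zs ls' N bs Cs \<M> N1 \<M>1 \<sigma> Cs1 z N2 \<mu> nsx z' Cs2 N3 x e' a)
  note ls = TLoop.hyps(1,2) and zs = TLoop.hyps(4,5) and ls' = TLoop.hyps(6,7,8)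
  have as: "as = rvars \<Gamma>" using TLoop.hyps(3) TLoop.prems(4) by simp
  note bs = TLoop.hyps(9)[unfolded as]
  let ?loop = "Let x nsx (Loop a \<sigma> e1) e2"
  let ?\<Gamma>C = "\<Gamma> @ ctx_bindings C"
  interpret P: coherent M N \<M> \<Gamma> \<Delta> "fill C ?loop" by (rule TLoop.prems)
  have bnd: "bound (fill C ?loop) = map fst C @ x # bound e1 @ bound e2"
    by (simp add: bound_fill_simple TLoop.prems)
  have bs_keys: "map fst bs = ls'" unfolding bs by (rule map2_keys[OF ls'(1)])
  have ls_defs: "set ls \<subseteq> defs C" using ls(2) by auto
  have typed_loop: "ctyp M T ?\<Gamma>C ?loop [ns]" by (rule ctyp_fillD[OF TLoop.prems(3)])
  then have typed_v: "ctyp_val M T ?\<Gamma>C (Loop a \<sigma> e1) nsx"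
    and typed_e2: "ctyp M T (?\<Gamma>C @ [TVar x nsx]) e2 [ns]"
    by (auto elim: ctyp_LetE)
  obtain ns1 where typed_e1: "ctyp M T (?\<Gamma>C @ [RVar a]) e1 [ns1]"
    and a: "RVar a \<notin> set ?\<Gamma>C" "a \<in> dom M" and shape: "loop_shape M a \<sigma> ns1 nsx"
    by (rule ctyp_val_Loop[OF typed_v])
  have axis: "axis \<sigma> = a" using shape by (auto simp: loop_shape_def split: action.splits)
  \<comment> \<open>If \<open>ls\<close> is empty, no \<open>let\<close> is emitted, and
    \<open>bs\<close> is empty as well.\<close>
  have bindings_Cs: "sctx_bindings Cs = bs" using TLoop.hyps(10) ls'(1) by (auto simp: bs split: if_splits)
  have N1: "N \<union> set ls' \<subseteq> N1"
    using sctx_bindings_sbound[of Cs] bs_keys by (auto simp: TLoop.hyps(11) bindings_Cs simp flip: set_map)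
  have coh1: "coherent M N1 \<M>1 ?\<Gamma>C (\<Delta> @ bs) ?loop"
    unfolding TLoop.hyps(12)
    by (rule coherent_fill[OF TLoop.prems(1,2) ls(1) ls_defs _ ls' bs N1]) (auto simp: ls(2))
  interpret L: coherent M N1 \<M>1 ?\<Gamma>C "\<Delta> @ bs" ?loop by (rule coh1)
  have typed_ls: "ctyp M T \<Gamma> (fill C (Yield (map fst ls))) (map snd ls)"
    using subsetD[OF ls_defs nth_mem]
    by (intro ctyp_fill_replace[OF TLoop.prems(3)] ctyp_Yield)
      (auto simp: list_all2_conv_all_nth TVar_in_ctx_bindings)
  have bs_types: "map snd bs = map (dtensor (rvars \<Gamma>)) (map snd ls)"
    unfolding bs using ls'(1) by (auto intro!: nth_equalityI simp: case_prod_unfold)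
  have fst_ls: "set (map fst ls) \<subseteq> fst ` defs C" using ls_defs by auto
  have Cs_styp: "styp M T \<Delta> (sfill Cs e'') \<mu>s" if "styp M T (\<Delta> @ bs) e'' \<mu>s" for e'' \<mu>s
  proof (cases "ls = []")
    case True
    then show ?thesis using that TLoop.hyps(10) by (simp add: bs)
  next
    case False
    then obtain ys where ys: "length ys = length zs" "distinct ys" "set ys \<inter> N = {}"
      and Cs: "Cs = [(bs, Execute (rvars \<Gamma>) (map (vapp \<M>) zs) ys
        (subst (ren zs ys) (fill C (Yield (map fst ls)))))]"
      using TLoop.hyps(10) by (auto simp: as)
    have "fst ` set bs \<inter> fst ` set \<Delta> = {}" "distinct (map fst bs)"
      using L.distinct_\<Delta> by auto
    then show ?thesis
      using P.execute_context_styp[OF refl TLoop.prems(2) typed_ls fst_ls zs ys refl] that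
      by (auto simp: Cs bs_types intro!: styp_Let)
  qed
  have Cs_env: "env_rel \<M>1 (ctx_env M F C \<gamma>) (sctx_env M F \<Delta> Cs \<gamma>')"
    if "valid_env M \<Gamma> \<gamma>" "env_rel \<M> \<gamma> \<gamma>'" for \<gamma> \<gamma>'
  proof (cases "ls = []")
    case True
    \<comment> \<open>The instance without emitted values: what \<open>C\<close> defines is free
      neither in the loop body nor in the continuation.\<close>
    then show ?thesis
      using env_rel_fill[OF TLoop.prems(1,2) ls' bs that(2), of "[]" F] TLoop.hyps(10) ls'(1)
      by (simp add: TLoop.hyps(12))
  next
    case False
    then obtain ys where ys: "length ys = length zs" "distinct ys" "set ys \<inter> N = {}"
      and Cs: "Cs = [(bs, Execute (rvars \<Gamma>) (map (vapp \<M>) zs) ys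
        (subst (ren zs ys) (fill C (Yield (map fst ls)))))]"
      using TLoop.hyps(10) by (auto simp: as)
    have "csem M F (fill C (Yield (map fst ls))) \<gamma> = map (\<lambda>x. the (fst (ctx_env M F C \<gamma>) x)) (map fst ls)"
      by (simp add: csem_fill)
    with P.execute_context_sem[OF refl TLoop.prems(2) typed_ls fst_ls zs ys refl that]
    have "env_rel (\<M> @ zip ls bs) (ctx_env M F C \<gamma>) (\<gamma>'(ls' [\<mapsto>] ssem_val M F \<Delta>
        (Execute (rvars \<Gamma>) (map (vapp \<M>) zs) ys (subst (ren zs ys) (fill C (Yield (map fst ls))))) \<gamma>'))"
      by (intro env_rel_fill[OF TLoop.prems(1,2) ls' bs that(2)]) simp
    then show ?thesis by (simp add: Cs TLoop.hyps(12) bs_keys)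
  qed
  have coh_e1: "coherent M N1 \<M>1 (?\<Gamma>C @ [RVar a]) (\<Delta> @ bs) (fill [] e1)"
    using coherent_body[OF coh1 a] by simp
  have rvars_a: "axes (\<sigma>s @ [\<sigma>]) = rvars (?\<Gamma>C @ [RVar a])" "rvars (?\<Gamma>C @ [RVar a]) = rvars \<Gamma> @ [a]"
    using TLoop.prems(4) by (simp_all add: axes_def axis)
  have "styp M T (\<Delta> @ bs) (sfill Cs1 (SYield [z])) [dtensor (rvars \<Gamma> @ [a]) ns1]"
    and sem1: "\<And>\<gamma> \<gamma>'. valid_env M (?\<Gamma>C @ [RVar a]) \<gamma> \<Longrightarrow> env_rel \<M>1 \<gamma> \<gamma>' \<Longrightarrow>
      hd (ssem M F (\<Delta> @ bs) (sfill Cs1 (SYield [z])) \<gamma>') (map (\<lambda>b. the (snd \<gamma> b)) (rvars \<Gamma> @ [a]))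
        = hd (csem M F e1 \<gamma>)"
    using TLoop.IH(1)[OF coh_e1 simple_simps(1) _ rvars_a(1), of ns1] typed_e1
    unfolding rvars_a(2) fill_simps(1) by blast+
  note styp1 = this(1)
  let ?\<Delta>1 = "\<Delta> @ bs @ sctx_bindings Cs1"
  \<comment> \<open>Here the typing half of the hypothesis is used: it gives the type that the
    reduction looks up for \<open>z\<close>.\<close>
  have z: "(z, dtensor (rvars ?\<Gamma>C @ [a]) ns1) \<in> set ?\<Delta>1"
    using styp_sfillD[OF styp1] by (auto elim!: styp_SYieldE)
  have dist1: "distinct (map fst ?\<Delta>1)"
    using styp_sfill_distinct[OF styp1 L.distinct_\<Delta>] by simp
  have N2: "fst ` set ?\<Delta>1 \<subseteq> N2"
    using L.\<Delta>_N sctx_bindings_sbound[of Cs1] by (auto simp: TLoop.hyps(14))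
  \<comment> \<open>The body is translated under at least one action, so all names on its spine are
    new.\<close>
  have fresh1: "fst ` set (sctx_bindings Cs1) \<inter> N1 = {}"
    using trans_avoid_slet_bound[OF TLoop.hyps(13)] by simp
  have rvars_C: "rvars ?\<Gamma>C = rvars \<Gamma>" by simp
  note reduce = reduce_loop[OF mesh ops typed_e1 a(2) shape z dist1 N2 TLoop.hyps(16)]
  have Cs2: "case \<sigma> of
        Sum b \<Rightarrow> Cs2 = [([(z', dtensor (rvars ?\<Gamma>C) nsx)], TileReduce (Sum b) z)]
      | Tile b d \<Rightarrow> \<exists>z0. z0 \<notin> N2 \<and> z0 \<noteq> z' \<and>
          Cs2 = [([(z0, DTensor (rvars ?\<Gamma>C) ((map (Pair []) nsx)[d := ([b], nsx ! d)]))], TileReduce (Tile b d) z),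
                ([(z', dtensor (rvars ?\<Gamma>C) nsx)], Redistribute z0 (dtensor (rvars ?\<Gamma>C) nsx))]"
    using TLoop.hyps(17) unfolding TLoop.hyps(15) as rvars_C .
  note reduce = reduce[OF Cs2]
  let ?\<Delta>' = "sctx_bindings Cs1 @ sctx_bindings Cs2"
  have fresh: "fst ` set ?\<Delta>' \<inter> N1 = {}"
    using fresh1 reduce(2) by (auto simp: TLoop.hyps(14) image_Un)
  have "coherent M N3 (\<M>1 @ [((x, nsx), (z', dtensor (rvars ?\<Gamma>C) nsx))]) (?\<Gamma>C @ [TVar x nsx])
      ((\<Delta> @ bs) @ ?\<Delta>') (fill [] e2)"
    unfolding fill_simps(1)
  proof (rule coherent_Let[OF coh1])
    show "distinct (map fst ((\<Delta> @ bs) @ ?\<Delta>'))" using reduce(1) by simp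
    \<comment> \<open>The names emitted for the body were chosen outside \<open>N1\<close>, hence
      away from the continuation.\<close>
    have "names e2 \<subseteq> N1" using L.names_N by (auto simp: names_def)
    then show "fst ` set ?\<Delta>' \<inter> names e2 = {}" using fresh by auto
    show "N1 \<union> fst ` set ?\<Delta>' \<subseteq> N3"
      using sctx_bindings_sbound[of Cs1] sctx_bindings_sbound[of Cs2]
      by (auto simp: TLoop.hyps(14,18))
    show "(z', dtensor (rvars ?\<Gamma>C) nsx) \<in> set ?\<Delta>'" using reduce(3) by simp
  qed
  then have coh2: "coherent M N3 (\<M>1 @ [((x, nsx), (z', \<mu>))]) (?\<Gamma>C @ [TVar x nsx])
      (?\<Delta>1 @ sctx_bindings Cs2) (fill [] e2)"
    by (simp add: TLoop.hyps(15) as)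
  have rvars_x: "axes \<sigma>s = rvars (?\<Gamma>C @ [TVar x nsx])" "rvars (?\<Gamma>C @ [TVar x nsx]) = rvars \<Gamma>"
    using TLoop.prems(4) by simp_all
  have "styp M T (?\<Delta>1 @ sctx_bindings Cs2) e' [dtensor (rvars \<Gamma>) ns]"
    and sem2: "\<And>\<gamma> \<gamma>'. valid_env M (?\<Gamma>C @ [TVar x nsx]) \<gamma> \<Longrightarrow>
      env_rel (\<M>1 @ [((x, nsx), (z', dtensor (rvars \<Gamma>) nsx))]) \<gamma> \<gamma>' \<Longrightarrow>
      hd (ssem M F (?\<Delta>1 @ sctx_bindings Cs2) e' \<gamma>') (map (\<lambda>b. the (snd \<gamma> b)) (rvars \<Gamma>))
        = hd (csem M F e2 \<gamma>)"
    using TLoop.IH(2)[OF coh2 simple_simps(1) _ rvars_x(1), of ns] typed_e2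
    unfolding rvars_x(2) TLoop.hyps(15) as fill_simps(1) by blast+
  note styp2 = this(1)
  have "styp M T \<Delta> (sfill Cs (sfill Cs1 (sfill Cs2 e'))) [dtensor (rvars \<Gamma>) ns]"
    using reduce(4)[OF styp2] by (intro Cs_styp styp_sfill_replace[OF styp1]) simp
  moreover have "hd (ssem M F \<Delta> (sfill Cs (sfill Cs1 (sfill Cs2 e'))) \<gamma>') (map (\<lambda>b. the (snd \<gamma> b)) (rvars \<Gamma>))
      = hd (csem M F (fill C ?loop) \<gamma>)" if valid: "valid_env M \<Gamma> \<gamma>" and rel: "env_rel \<M> \<gamma> \<gamma>'" for \<gamma> \<gamma>'
  proof -
    define \<gamma>C where "\<gamma>C = ctx_env M F C \<gamma>"
    define \<gamma>1 where "\<gamma>1 = sctx_env M F \<Delta> Cs \<gamma>'"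
    define \<gamma>2 where "\<gamma>2 = sctx_env M F (\<Delta> @ bs) Cs1 \<gamma>1"
    define \<gamma>3 where "\<gamma>3 = sctx_env M F ?\<Delta>1 Cs2 \<gamma>2"
    have snd_\<gamma>C: "snd \<gamma>C = snd \<gamma>" by (simp add: \<gamma>C_def)
    have valid_C: "valid_env M ?\<Gamma>C \<gamma>C"
      using valid typed_env_ctx_env[OF TLoop.prems(3) mesh ops] by (simp add: valid_env_def \<gamma>C_def)
    have rel1: "env_rel \<M>1 \<gamma>C \<gamma>1" unfolding \<gamma>C_def \<gamma>1_def by (rule Cs_env[OF valid rel])
    have a_notin: "a \<notin> set (rvars \<Gamma>)" using a(1) by (simp add: in_set_rvars)
    \<comment> \<open>\<open>\<gamma>2\<close> does not depend on \<open>j\<close>: the translated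
      body is evaluated once, and its value at last index \<open>j\<close> is that of iteration
      \<open>j\<close>.\<close>
    have "the (\<gamma>2 z) (map (\<lambda>b. the (snd \<gamma>C b)) (rvars ?\<Gamma>C) @ [j])
        = hd (csem M F e1 (fst \<gamma>C, (snd \<gamma>C)(a \<mapsto> j)))" if j: "j < the (M a)" for j
    proof -
      have "valid_env M (?\<Gamma>C @ [RVar a]) (fst \<gamma>C, (snd \<gamma>C)(a \<mapsto> j))"
        using valid_C j by (auto simp: valid_env_def simp flip: append_assoc)
      moreover have "env_rel \<M>1 (fst \<gamma>C, (snd \<gamma>C)(a \<mapsto> j)) \<gamma>1"
        using L.image_stacked a_notin by (intro env_rel_fun_upd[OF rel1]) fastforce
      moreover have *: "map (\<lambda>b. the (((snd \<gamma>C)(a \<mapsto> j)) b)) (rvars \<Gamma> @ [a])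
          = map (\<lambda>b. the (snd \<gamma>C b)) (rvars ?\<Gamma>C) @ [j]"
        using a_notin by auto
      ultimately show ?thesis
        using sem1[of "(fst \<gamma>C, (snd \<gamma>C)(a \<mapsto> j))" \<gamma>1, unfolded snd_conv *]
        by (simp add: ssem_sfill \<gamma>2_def)
    qed
    from reduce(5)[where \<gamma>' = \<gamma>2, OF valid_C this]
    have z'_val: "the (\<gamma>3 z') (map (\<lambda>b. the (snd \<gamma>C b)) (rvars \<Gamma>)) = csem_val M F (Loop a \<sigma> e1) \<gamma>C"
      by (simp add: \<gamma>3_def)
    have x_notin: "x \<notin> set (tvars ?\<Gamma>C)" using L.bound_tvars by simp
    have rel3: "env_rel (\<M>1 @ [((x, nsx), (z', dtensor (rvars \<Gamma>) nsx))])
        ((fst \<gamma>C)(x \<mapsto> csem_val M F (Loop a \<sigma> e1) \<gamma>C), snd \<gamma>C) \<gamma>3"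
    proof (rule env_rel_Let[where \<gamma>'' = \<gamma>3 and as = "rvars \<Gamma>", OF rel1 _ _ z'_val])
      show "x \<notin> set (vdom \<M>1)" using L.vdom_tvars x_notin by blast
      fix u ms y \<mu> assume "((u, ms), (y, \<mu>)) \<in> set \<M>1"
      \<comment> \<open>Earlier images are not overwritten, since everything emitted for the body
        and its reduction lies outside \<open>N1\<close>.\<close>
      then have "y \<in> N1" using L.image_\<Delta> L.\<Delta>_N by force
      then have "y \<notin> fst ` set ?\<Delta>'" using fresh by blast
      then show "\<gamma>3 y = \<gamma>1 y" by (simp add: \<gamma>3_def \<gamma>2_def sctx_env_notin image_Un)
    qed
    have typed_C: "typed_env ?\<Gamma>C (fst \<gamma>C)" using valid_C by (simp add: valid_env_def)
    have valid3: "valid_env M (?\<Gamma>C @ [TVar x nsx])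
        ((fst \<gamma>C)(x \<mapsto> csem_val M F (Loop a \<sigma> e1) \<gamma>C), snd \<gamma>C)"
      using valid_C typed_env_Let[OF typed_C csem_val_in_tensors[OF typed_v mesh ops typed_C] x_notin]
      unfolding valid_env_def by auto
    show ?thesis
      using sem2[OF valid3 rel3]
      by (simp add: ssem_sfill csem_fill bindings_Cs snd_\<gamma>C \<gamma>3_def \<gamma>2_def \<gamma>1_def \<gamma>C_def)
  qed
  ultimately show ?case by blast
qed

section \<open>The initial SPMD context\<close>

lemma set_spmd_ctxt:
  "(y, \<mu>) \<in> set (spmd_ctxt \<Gamma> \<M>) \<longleftrightarrow> (\<exists>x ms. x \<in> set (tvars \<Gamma>) \<and> ((x, ms), (y, \<mu>)) \<in> set \<M>)"
  by (force simp: spmd_ctxt_def split: if_splits)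

text \<open>Different Core variables contribute disjoint blocks of names, because the images are
  distinct.\<close>

lemma distinct_spmd_ctxt:
  assumes "distinct (tvars \<Gamma>)" and img: "distinct (vimg \<M>)"
  shows "distinct (map fst (spmd_ctxt \<Gamma> \<M>))"
proof -
  define f where "f = (\<lambda>x. map fst [(y, \<mu>). ((x', ns), (y, \<mu>)) \<leftarrow> \<M>, x' = x])"
  have f_filter: "f x = vimg (filter (\<lambda>((x', ns), y, \<mu>). x' = x) \<M>)" for x
    unfolding f_def vimg_def by (induction \<M>) auto
  have "distinct (f x)" for x
    unfolding f_filter using img by (auto simp: vimg_def distinct_map intro: inj_on_subset)
  moreover have "x = x'" if "y \<in> set (f x)" "y \<in> set (f x')" for x x' y
    using that img unfolding f_filter vimg_def distinct_map inj_on_def by fastforce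
  ultimately have "distinct (concat (map f xs))" if "distinct xs" for xs
    using that by (induction xs) (auto simp: disjoint_iff)
  moreover have "map fst (spmd_ctxt \<Gamma> \<M>) = concat (map f (tvars \<Gamma>))"
    by (simp add: spmd_ctxt_def map_concat f_def comp_def)
  ultimately show ?thesis using assms(1) by simp
qed

text \<open>Cutting \<open>\<Gamma>\<close> at \<open>x\<close> shows the axes recorded for
  \<open>x\<close> to be a prefix of all range variables. An image is a variable of
  \<open>\<Gamma>\<close> or foreign to the program, so it is never one of its binders.\<close>

lemma compatible_coherent:
  assumes \<Gamma>: "wf_cctx M \<Gamma>" and naming: "naming_convention \<Gamma> \<M> p" and comp: "compatible \<Gamma> \<M>"
  shows "coherent M (names p \<union> set (vdom \<M>) \<union> set (vimg \<M>)) \<M> \<Gamma> (spmd_ctxt \<Gamma> \<M>) p"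
proof -
  have vmap: "distinct (vdom \<M>)" "distinct (vimg \<M>)" "set (vdom \<M>) = set (tvars \<Gamma>)"
    using comp by (auto simp: compatible_def wf_vmap_def)
  have entry: "\<exists>y bs. ((x, ms), (y, dtensor bs ms)) \<in> set \<M> \<and> take (length bs) (rvars \<Gamma>) = bs"
    if "TVar x ms \<in> set \<Gamma>" for x ms
  proof -
    from that obtain \<Gamma>1 \<Gamma>2 where split: "\<Gamma> = \<Gamma>1 @ TVar x ms # \<Gamma>2" by (meson split_list)
    then obtain y where "((x, ms), (y, dtensor (rvars \<Gamma>1) ms)) \<in> set \<M>"
      using comp unfolding compatible_def by blast
    then show ?thesis by (intro exI[of _ y] exI[of _ "rvars \<Gamma>1"]) (simp add: split)
  qed
  have img_fresh: "y = x \<or> y \<notin> names p" if "((x, ms), (y, \<mu>)) \<in> set \<M>" for x ms y \<mu>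
    using that naming by (force simp: naming_convention_def)
  have in_vimg: "y \<in> set (vimg \<M>)" if "((x, ms), (y, \<mu>)) \<in> set \<M>" for x ms y \<mu>
    using that by (force simp: vimg_def)
  show ?thesis
  proof
    fix x ms y \<mu> assume xy: "((x, ms), (y, \<mu>)) \<in> set \<M>"
    have x: "x \<in> set (tvars \<Gamma>)" using in_vdom[OF xy] vmap(3) by blast
    then show "(y, \<mu>) \<in> set (spmd_ctxt \<Gamma> \<M>)" using xy by (auto simp: set_spmd_ctxt)
    from x obtain ns where "TVar x ns \<in> set \<Gamma>" by (auto simp: in_set_tvars)
    then obtain y' bs where y': "((x, ns), (y', dtensor bs ns)) \<in> set \<M>" "take (length bs) (rvars \<Gamma>) = bs"
      using entry by blast
    have "\<mu> = dtensor bs ns"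
      using vmap(1) xy y'(1) unfolding vdom_def distinct_map inj_on_def by fastforce
    then show "set (stacked \<mu>) \<subseteq> set (rvars \<Gamma>)" using y'(2) by (metis dtensor_simps(1) set_take_subset)
  next
    show "fst ` set (spmd_ctxt \<Gamma> \<M>) \<subseteq> names p \<union> set (vdom \<M>) \<union> set (vimg \<M>)"
      using in_vimg by (auto simp: set_spmd_ctxt)
    show "fst ` set (spmd_ctxt \<Gamma> \<M>) \<inter> set (bound p) = {}"
      using img_fresh naming by (fastforce simp: set_spmd_ctxt naming_convention_def names_def)
    show "distinct (map fst (spmd_ctxt \<Gamma> \<M>))"
      using \<Gamma> vmap by (intro distinct_spmd_ctxt) (auto simp: wf_cctx_def)
  qed (use \<Gamma> naming vmap entry img_fresh in \<open>auto simp: wf_cctx_def naming_convention_def\<close>)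
qed

lemma cenvs_valid: "\<gamma> \<in> cenvs M \<Gamma> \<Longrightarrow> valid_env M \<Gamma> \<gamma>"
  by (fastforce simp: cenvs_def valid_env_def typed_env_def in_set_rvars)

theorem theoremC7:
  fixes M :: "'a mesh"
    and T :: "'op \<Rightarrow> shape list \<Rightarrow> shape option"
    and F :: "'op \<Rightarrow> 'r::comm_monoid_add tensor list \<Rightarrow> 'r tensor"
    and \<Gamma> :: "('v, 'a) cctx"
    and C :: "('v, 'a, 'op) ctx"
    and e :: "('v, 'a, 'op) cexpr"
    and e' :: "('v, 'a, 'op) sexpr"
    and ns :: shape
    and \<sigma>s :: "'a action list"
    and as :: "'a list"
    and \<M> :: "('v, 'a) vmap"
    and \<gamma> :: "('v, 'a, 'r) cenv"
    and \<gamma>' :: "('v, 'r) senv"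
  assumes "wf_mesh M"
    and "wf_ops T F"
    and "wf_cctx M \<Gamma>"
    and "simple C"
    and "ctyp M T \<Gamma> (fill C e) [ns]"
    and "naming_convention \<Gamma> \<M> (fill C e)"
    and "axes \<sigma>s = as"
    and "rvars \<Gamma> = as"
    and "\<gamma> \<in> cenvs M \<Gamma>"
    and "\<gamma>' \<in> senvs M (spmd_ctxt \<Gamma> \<M>)"
    and "compatible \<Gamma> \<M>"
    and "translates \<M> \<sigma>s C e e'"
    and "env_rel \<M> \<gamma> \<gamma>'"
  shows "styp M T (spmd_ctxt \<Gamma> \<M>) e' [dtensor as ns] \<and>
    hd (ssem M F (spmd_ctxt \<Gamma> \<M>) e' \<gamma>') (map (\<lambda>a. the (snd \<gamma> a)) as)
      = hd (csem M F (fill C e) \<gamma>)"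
proof -
  have "rvars \<Gamma> = as" "axes \<sigma>s = rvars \<Gamma>" using assms(7,8) by simp_all
  with trans_avoid_correct[OF assms(12)[unfolded translates_def] assms(1,2)
      compatible_coherent[OF assms(3,6,11)] assms(4,5)]
    cenvs_valid[OF assms(9)] assms(13)
  show ?thesis by blast
qed

end
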